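(* Let $G$ be a finite group, let $\theta:G\to G$ be an involution, and let $H\subset G$ be a subgroup. Let $\sigma:G\to G$ be given by $\sigma(g)=\theta(g^{-1})$; it maps $(H,\theta(H))$-double cosets to $(H,\theta(H))$-double cosets. Then $$\#\{O\in H\backslash G/\theta(H):\sigma(O)\neq O\}=\sum_{\pi\in\mathrm{irr}(G)}\dim(\pi^H)\left(\dim(\pi^{\theta(H)})-\varepsilon_\theta(\pi)\right).$$
   Context: All representations are finite-dimensional complex representations. An involution $\theta:G\to G$ is a group automorphism with $\theta\circ\theta=\mathrm{id}_G$. $\mathrm{irr}(G)$ is the set of isomorphism classes of irreducible representations of $G$; $\pi^*$ is the dual representation, $\pi\circ\theta$ is $g\mapsto\pi(\theta(g))$, and $\pi^K$ is the space of $K$-invariant vectors for a subgroup $K$. The twisted Frobenius–Schur indicator of $\pi\in\mathrm{irr}(G)$ is defined by: $\varepsilon_\theta(\pi)=0$ if $\pi\not\simeq\pi^*\circ\theta$; $\varepsilon_\theta(\pi)=1$ if $\pi$ possesses a non-zero symmetric bilinear form $B$ with $B(\pi(g)v,w)=B(v,\pi(\theta(g^{-1}))w)$ for all $g,v,w$; $\varepsilon_\theta(\pi)=-1$ if $\pi$ possesses a non-zero anti-symmetric bilinear form $B$ with the same property. (Exactly one of these cases occurs.) *)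

theory Defs
  imports "HOL-Algebra.Algebra" "Jordan_Normal_Form.VS_Connect"
begin

text \<open>
  A finite-dimensional complex representation is taken on a coordinate space: it is a pair
  \<open>(n, \<rho>)\<close> with \<open>\<rho>\<close> a homomorphism into the unit group of the ring of complex
  \<open>n\<times>n\<close> matrices. Up to isomorphism every representation has this form. The values of
  \<open>\<rho>\<close> outside \<open>carrier G\<close> are arbitrary; no definition below depends on them, provided that
  \<open>K \<subseteq> carrier G\<close> and that \<open>\<theta>\<close> maps \<open>carrier G\<close> into itself.
\<close>

type_synonym 'a rep = "nat \<times> ('a \<Rightarrow> complex mat)"

abbreviation rep_space :: "'a rep \<Rightarrow> (complex, complex vec) module" where
  "rep_space \<pi> \<equiv> module_vec TYPE(complex) (fst \<pi>)"

definition is_rep :: "('a, 'b) monoid_scheme \<Rightarrow> 'a rep \<Rightarrow> bool" where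
  "is_rep G \<pi> \<longleftrightarrow> snd \<pi> \<in> hom G (units_of (ring_mat TYPE(complex) (fst \<pi>) ()))"

definition irreducible_rep :: "('a, 'b) monoid_scheme \<Rightarrow> 'a rep \<Rightarrow> bool" where
  "irreducible_rep G \<pi> \<longleftrightarrow> is_rep G \<pi> \<and> fst \<pi> \<noteq> 0 \<and>
     (\<forall>W. subspace class_ring W (rep_space \<pi>) \<longrightarrow>
          (\<forall>g\<in>carrier G. \<forall>w\<in>W. snd \<pi> g *\<^sub>v w \<in> W) \<longrightarrow>
          W = {0\<^sub>v (fst \<pi>)} \<or> W = carrier_vec (fst \<pi>))"

text \<open>Invertible matrices are square, so isomorphic representations have equal dimension.\<close>

definition rep_iso :: "('a, 'b) monoid_scheme \<Rightarrow> 'a rep \<Rightarrow> 'a rep \<Rightarrow> bool" where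
  "rep_iso G \<pi> \<tau> \<longleftrightarrow>
     (\<exists>T\<in>carrier_mat (fst \<tau>) (fst \<pi>). invertible_mat T \<and>
        (\<forall>g\<in>carrier G. T * snd \<pi> g = snd \<tau> g * T))"

definition irr :: "('a, 'b) monoid_scheme \<Rightarrow> 'a rep set set" where
  "irr G = {\<pi>. irreducible_rep G \<pi>} //
     {(\<pi>, \<tau>). irreducible_rep G \<pi> \<and> irreducible_rep G \<tau> \<and> rep_iso G \<pi> \<tau>}"

text \<open>The dual space is identified with the coordinate space by means of the dual basis,
  in which the transposed operator has the transposed matrix.\<close>

definition dual_rep :: "('a, 'b) monoid_scheme \<Rightarrow> 'a rep \<Rightarrow> 'a rep" where
  "dual_rep G \<pi> = (fst \<pi>, \<lambda>g. transpose_mat (snd \<pi> (inv\<^bsub>G\<^esub> g)))"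

definition twist_rep :: "'a rep \<Rightarrow> ('a \<Rightarrow> 'a) \<Rightarrow> 'a rep" where
  "twist_rep \<pi> \<theta> = (fst \<pi>, \<lambda>g. snd \<pi> (\<theta> g))"

definition invariants :: "'a rep \<Rightarrow> 'a set \<Rightarrow> complex vec set" where
  "invariants \<pi> K = {v \<in> carrier_vec (fst \<pi>). \<forall>k\<in>K. snd \<pi> k *\<^sub>v v = v}"

definition dim_invariants :: "'a rep \<Rightarrow> 'a set \<Rightarrow> nat" where
  "dim_invariants \<pi> K =
     vectorspace.dim class_ring ((rep_space \<pi>)\<lparr>carrier := invariants \<pi> K\<rparr>)"

definition bilinear_form :: "nat \<Rightarrow> (complex vec \<Rightarrow> complex vec \<Rightarrow> complex) \<Rightarrow> bool" where
  "bilinear_form n B \<longleftrightarrow>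
     (\<forall>u\<in>carrier_vec n. \<forall>v\<in>carrier_vec n. \<forall>w\<in>carrier_vec n.
        B (u + v) w = B u w + B v w \<and> B w (u + v) = B w u + B w v) \<and>
     (\<forall>c. \<forall>v\<in>carrier_vec n. \<forall>w\<in>carrier_vec n.
        B (c \<cdot>\<^sub>v v) w = c * B v w \<and> B v (c \<cdot>\<^sub>v w) = c * B v w)"

text \<open>Non-zero forms \<open>B\<close> with the twisted invariance property that are symmetric
  (\<open>s = 1\<close>) or anti-symmetric (\<open>s = -1\<close>).\<close>

definition has_twisted_form ::
  "('a, 'b) monoid_scheme \<Rightarrow> ('a \<Rightarrow> 'a) \<Rightarrow> 'a rep \<Rightarrow> complex \<Rightarrow> bool" where
  "has_twisted_form G \<theta> \<pi> s \<longleftrightarrow>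
     (\<exists>B. bilinear_form (fst \<pi>) B \<and>
        (\<exists>v\<in>carrier_vec (fst \<pi>). \<exists>w\<in>carrier_vec (fst \<pi>). B v w \<noteq> 0) \<and>
        (\<forall>v\<in>carrier_vec (fst \<pi>). \<forall>w\<in>carrier_vec (fst \<pi>). B w v = s * B v w) \<and>
        (\<forall>g\<in>carrier G. \<forall>v\<in>carrier_vec (fst \<pi>). \<forall>w\<in>carrier_vec (fst \<pi>).
           B (snd \<pi> g *\<^sub>v v) w = B v (snd \<pi> (\<theta> (inv\<^bsub>G\<^esub> g)) *\<^sub>v w)))"

text \<open>The three cases are exhaustive and mutually exclusive when \<open>\<pi>\<close> is irreducible and
  \<open>\<theta>\<close> is an involution.\<close>

definition twisted_FS :: "('a, 'b) monoid_scheme \<Rightarrow> ('a \<Rightarrow> 'a) \<Rightarrow> 'a rep \<Rightarrow> int" where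
  "twisted_FS G \<theta> \<pi> = (THE e.
     (e = 0 \<and> \<not> rep_iso G \<pi> (twist_rep (dual_rep G \<pi>) \<theta>)) \<or>
     (e = 1 \<and> has_twisted_form G \<theta> \<pi> 1) \<or>
     (e = -1 \<and> has_twisted_form G \<theta> \<pi> (-1)))"

text \<open>For \<open>K \<subseteq> carrier G\<close> and an involution \<open>\<theta>\<close>, \<open>dim_invariants\<close> and
  \<open>twisted_FS\<close> take equal values on isomorphic irreducible representations, so it does
  not matter which element of a class is chosen.\<close>

definition representative :: "'a rep set \<Rightarrow> 'a rep" where
  "representative C = (SOME \<pi>. \<pi> \<in> C)"

definition double_cosets :: "('a, 'b) monoid_scheme \<Rightarrow> 'a set \<Rightarrow> 'a set \<Rightarrow> 'a set set" where
  "double_cosets G H K = {H <#>\<^bsub>G\<^esub> {g} <#>\<^bsub>G\<^esub> K | g. g \<in> carrier G}"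

definition involution :: "('a, 'b) monoid_scheme \<Rightarrow> ('a \<Rightarrow> 'a) \<Rightarrow> bool" where
  "involution G \<theta> \<longleftrightarrow> \<theta> \<in> iso G G \<and> (\<forall>g\<in>carrier G. \<theta> (\<theta> g) = g)"

end

theory Submission
  imports Defs "Jordan_Normal_Form.Spectral_Radius"
begin

text \<open>
  Write \<open>K = \<theta>(H)\<close>. Let \<open>F\<close> be the identity or \<open>\<sigma>\<close>; it maps double cosets \<open>HgK\<close> to double
  cosets. By the orbit-counting argument of Burnside, \<open>|H| |K|\<close> times the number of double cosets
  that \<open>F\<close> maps to themselves is the number of triples \<open>(h, k, g)\<close> with \<open>h F(g) k = g\<close>
  (\<open>card_fixed_double_cosets\<close>). The claim is the difference of the two counts, for the identity
  and for \<open>\<sigma>\<close>.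

  The equation \<open>h F(g) k g\<inverse> = 1\<close> is detected by the character of the regular representation,
  \<open>\<Sum>\<^sub>\<pi> dim \<pi> \<cdot> \<chi>\<^sub>\<pi>(x) = |G|\<close> for \<open>x = 1\<close> and \<open>0\<close> otherwise (\<open>sum_dim_chi\<close>). Hence for each
  irreducible \<open>\<pi>\<close> one needs \<open>\<Sum>\<^sub>g \<chi>\<^sub>\<pi>(h F(g) k g\<inverse>)\<close>, and in both cases this is the trace of a product
  \<open>\<pi>(a) T\<close> with an element \<open>a\<close> of \<open>G\<close> and an operator \<open>T\<close> that commutes with \<open>\<pi>\<close>, hence is a scalar by
  Schur's lemma.

  For \<open>F = id\<close> the operator is \<open>\<Sum>\<^sub>g \<pi>(g k g\<inverse>)\<close>, with trace \<open>|G| \<chi>\<^sub>\<pi>(k)\<close> (\<open>sum_chi_conj_mult\<close>).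
  Summing over \<open>H\<close> and \<open>K\<close> turns characters into dimensions of invariants
  (\<open>sum_chi_subgroup\<close>), so there are \<open>\<Sum>\<^sub>\<pi> dim \<pi>\<^sup>H dim \<pi>\<^sup>K\<close> double cosets (\<open>card_double_cosets\<close>).

  For \<open>F = \<sigma>\<close> and \<open>k = \<theta>(h')\<close> the substitution \<open>x = g\<inverse> h'\<close> leads to the operator
  \<open>\<Sum>\<^sub>x \<pi>(x \<theta>(x))\<close>. Its trace is \<open>\<epsilon>\<^sub>\<theta>(\<pi>) |G|\<close>, the twisted version of the theorem of Frobenius and
  Schur (\<open>twisted_frobenius_schur\<close>), so \<open>\<Sum>\<^sub>\<pi> \<epsilon>\<^sub>\<theta>(\<pi>) dim \<pi>\<^sup>H\<close> double cosets are fixed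
  (\<open>card_fixed_double_cosets_FS\<close>). That theorem in turn is an orthogonality relation between \<open>\<pi>\<close>
  and \<open>\<pi>\<^sup>* \<circ> \<theta>\<close>: intertwiners between these two are the matrices of invariant bilinear forms, they
  form a space of dimension at most one, and transposition acts on that space by a sign.

  The character of the regular representation is computed with traces alone. In a basis adapted to
  an invariant subspace the matrices of a representation become block triangular, so every
  character is a sum of irreducible ones (\<open>character_decomposition\<close>); the multiplicities for the
  regular representation, and with them the finiteness of the set of irreducible classes, follow
  from the orthogonality of characters.
\<close>

section \<open>Traces and sums of complex matrices\<close>

definition mat_trace :: "complex mat \<Rightarrow> complex" where
  "mat_trace A = (\<Sum>i<dim_row A. A $$ (i, i))"

lemma mat_trace_carrier: "A \<in> carrier_mat n n \<Longrightarrow> mat_trace A = (\<Sum>i<n. A $$ (i, i))"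
  by (auto simp: mat_trace_def)

lemma mat_mult_index:
  assumes "A \<in> carrier_mat m n" "B \<in> carrier_mat n p" "i < m" "j < p"
  shows "(A * B) $$ (i, j) = (\<Sum>k<n. A $$ (i, k) * B $$ (k, j))"
  using assms by (auto simp: scalar_prod_def lessThan_atLeast0 intro!: sum.cong)

lemma mat_trace_mult:
  assumes "A \<in> carrier_mat m n" "B \<in> carrier_mat n m"
  shows "mat_trace (A * B) = (\<Sum>i<m. \<Sum>j<n. A $$ (i, j) * B $$ (j, i))"
  using assms mult_carrier_mat[OF assms]
  by (simp add: mat_trace_carrier[of _ m] mat_mult_index[of A m n B m] del: index_mult_mat)

lemma mat_trace_mult_commute:
  assumes "A \<in> carrier_mat m n" "B \<in> carrier_mat n m"
  shows "mat_trace (A * B) = mat_trace (B * A)"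
  unfolding mat_trace_mult[OF assms] mat_trace_mult[OF assms(2,1)]
  by (subst sum.swap) (simp add: mult.commute)

lemma mat_trace_similar:
  assumes "A \<in> carrier_mat n n" "P \<in> carrier_mat n m" "Q \<in> carrier_mat m n" "P * Q = 1\<^sub>m n"
  shows "mat_trace (Q * A * P) = mat_trace A"
proof -
  have "mat_trace (Q * A * P) = mat_trace (P * (Q * A))"
    using assms by (intro mat_trace_mult_commute[of _ m n]) auto
  also have "P * (Q * A) = (P * Q) * A"
    using assms by (intro assoc_mult_mat[symmetric]) auto
  finally show ?thesis using assms by simp
qed

lemma mat_trace_smult: "mat_trace (c \<cdot>\<^sub>m A) = c * mat_trace A" if "A \<in> carrier_mat n n"
  using that by (auto simp: mat_trace_def sum_distrib_left)

lemma mat_trace_one: "mat_trace (1\<^sub>m n) = of_nat n"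
  by (simp add: mat_trace_def)

text \<open>
  The traces of \<open>A * B\<close> and \<open>B * A\<close> agree, and they are the two sizes.
\<close>

lemma two_sided_inverse_imp_square:
  fixes A B :: "complex mat"
  assumes "A \<in> carrier_mat m n" "B \<in> carrier_mat n m" "A * B = 1\<^sub>m m" "B * A = 1\<^sub>m n"
  shows "m = n"
  using mat_trace_mult_commute[OF assms(1,2)] assms(3,4) by (simp add: mat_trace_one)

lemma invertible_matI:
  assumes "A \<in> carrier_mat n n" "B \<in> carrier_mat n n" "A * B = 1\<^sub>m n" "B * A = 1\<^sub>m n"
  shows "invertible_mat A"
  using assms unfolding invertible_mat_def inverts_mat_def by auto

lemma invertible_matE:
  assumes "invertible_mat A" "A \<in> carrier_mat m n"
  obtains B where "m = n" "B \<in> carrier_mat n n" "A * B = 1\<^sub>m n" "B * A = 1\<^sub>m n"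
proof -
  from assms have mn: "m = n" by (auto simp: invertible_mat_def)
  from assms obtain B where B: "A * B = 1\<^sub>m (dim_row A)" "B * A = 1\<^sub>m (dim_row B)"
    by (auto simp: invertible_mat_def inverts_mat_def)
  from arg_cong[OF B(1), of dim_col] arg_cong[OF B(2), of dim_col] assms(2) mn
  have "B \<in> carrier_mat n n" by auto
  then show thesis using that[OF mn] B assms mn by auto
qed

text \<open>
  The type of matrices has no zero that serves all sizes, so the additive structure on it is not
  that of a monoid type class and the ordinary sum operator does not apply; the entrywise sum does.
\<close>

definition mat_sum :: "nat \<Rightarrow> nat \<Rightarrow> ('i \<Rightarrow> complex mat) \<Rightarrow> 'i set \<Rightarrow> complex mat" where
  "mat_sum m n F A = mat m n (\<lambda>ij. \<Sum>x\<in>A. F x $$ ij)"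

lemma mat_sum_carrier [simp]: "mat_sum m n F A \<in> carrier_mat m n"
  by (simp add: mat_sum_def)

lemma mat_sum_index [simp]:
  "i < m \<Longrightarrow> j < n \<Longrightarrow> mat_sum m n F A $$ (i, j) = (\<Sum>x\<in>A. F x $$ (i, j))"
  by (simp add: mat_sum_def)

lemma mat_sum_cong:
  "(\<And>x. x \<in> A \<Longrightarrow> F x = F' x) \<Longrightarrow> mat_sum m n F A = mat_sum m n F' A"
  by (simp add: mat_sum_def cong: sum.cong)

lemma mat_sum_reindex:
  assumes "bij_betw f A B"
  shows "mat_sum m n (\<lambda>x. F (f x)) A = mat_sum m n F B"
  using assms by (auto simp: mat_sum_def intro!: cong_mat sum.reindex_bij_betw)

lemma mult_mat_sum:
  assumes "B \<in> carrier_mat p m" "\<And>x. x \<in> A \<Longrightarrow> F x \<in> carrier_mat m n"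
  shows "B * mat_sum m n F A = mat_sum p n (\<lambda>x. B * F x) A"
proof (rule eq_matI)
  fix i j assume ij: "i < dim_row (mat_sum p n (\<lambda>x. B * F x) A)"
    "j < dim_col (mat_sum p n (\<lambda>x. B * F x) A)"
  then have ij: "i < p" "j < n" by (auto simp: mat_sum_def)
  have "(B * mat_sum m n F A) $$ (i, j) = (\<Sum>k<m. B $$ (i, k) * (\<Sum>x\<in>A. F x $$ (k, j)))"
    using assms ij by (subst mat_mult_index[of _ p m _ n]) auto
  also have "\<dots> = (\<Sum>x\<in>A. \<Sum>k<m. B $$ (i, k) * F x $$ (k, j))"
    unfolding sum_distrib_left by (rule sum.swap)
  also have "\<dots> = (\<Sum>x\<in>A. (B * F x) $$ (i, j))"
    using assms ij by (intro sum.cong refl mat_mult_index[symmetric, of _ p m _ n]) auto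
  finally show "(B * mat_sum m n F A) $$ (i, j) = mat_sum p n (\<lambda>x. B * F x) A $$ (i, j)"
    using ij by simp
qed (use assms in \<open>auto simp: mat_sum_def\<close>)

lemma mat_sum_mult:
  assumes "B \<in> carrier_mat n p" "\<And>x. x \<in> A \<Longrightarrow> F x \<in> carrier_mat m n"
  shows "mat_sum m n F A * B = mat_sum m p (\<lambda>x. F x * B) A"
proof (rule eq_matI)
  fix i j assume ij: "i < dim_row (mat_sum m p (\<lambda>x. F x * B) A)"
    "j < dim_col (mat_sum m p (\<lambda>x. F x * B) A)"
  then have ij: "i < m" "j < p" by (auto simp: mat_sum_def)
  have "(mat_sum m n F A * B) $$ (i, j) = (\<Sum>k<n. (\<Sum>x\<in>A. F x $$ (i, k)) * B $$ (k, j))"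
    using assms ij by (subst mat_mult_index[of _ m n _ p]) auto
  also have "\<dots> = (\<Sum>x\<in>A. \<Sum>k<n. F x $$ (i, k) * B $$ (k, j))"
    unfolding sum_distrib_right by (rule sum.swap)
  also have "\<dots> = (\<Sum>x\<in>A. (F x * B) $$ (i, j))"
    using assms ij by (intro sum.cong refl mat_mult_index[symmetric, of _ m n _ p]) auto
  finally show "(mat_sum m n F A * B) $$ (i, j) = mat_sum m p (\<lambda>x. F x * B) A $$ (i, j)"
    using ij by simp
qed (use assms in \<open>auto simp: mat_sum_def\<close>)

lemma mat_trace_sum:
  assumes "\<And>x. x \<in> A \<Longrightarrow> F x \<in> carrier_mat n n"
  shows "mat_trace (mat_sum n n F A) = (\<Sum>x\<in>A. mat_trace (F x))"
proof -
  have "mat_trace (mat_sum n n F A) = (\<Sum>i<n. \<Sum>x\<in>A. F x $$ (i, i))"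
    by (simp add: mat_trace_carrier[of _ n])
  also have "\<dots> = (\<Sum>x\<in>A. mat_trace (F x))"
    using assms by (subst sum.swap) (auto intro!: sum.cong simp: mat_trace_carrier[of _ n])
  finally show ?thesis .
qed

lemma mat_sum_mult_vec_index:
  assumes "v \<in> carrier_vec n" "\<And>x. x \<in> A \<Longrightarrow> F x \<in> carrier_mat m n" "i < m"
  shows "(mat_sum m n F A *\<^sub>v v) $ i = (\<Sum>x\<in>A. (F x *\<^sub>v v) $ i)"
proof -
  have "(mat_sum m n F A *\<^sub>v v) $ i = (\<Sum>k<n. (\<Sum>x\<in>A. F x $$ (i, k)) * v $ k)"
    using assms by (auto simp: mat_sum_def scalar_prod_def lessThan_atLeast0 intro!: sum.cong)
  also have "\<dots> = (\<Sum>x\<in>A. \<Sum>k<n. F x $$ (i, k) * v $ k)"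
    unfolding sum_distrib_right by (rule sum.swap)
  also have "\<dots> = (\<Sum>x\<in>A. (F x *\<^sub>v v) $ i)"
  proof (rule sum.cong[OF refl])
    fix x assume "x \<in> A"
    with assms(2)[OF this] assms(1,3)
    show "(\<Sum>k<n. F x $$ (i, k) * v $ k) = (F x *\<^sub>v v) $ i"
      by (auto simp: scalar_prod_def lessThan_atLeast0 intro!: sum.cong)
  qed
  finally show ?thesis .
qed

definition mat_unit :: "nat \<Rightarrow> nat \<Rightarrow> nat \<Rightarrow> nat \<Rightarrow> complex mat" where
  "mat_unit m n k l = mat m n (\<lambda>(i, j). if i = k \<and> j = l then 1 else 0)"

lemma mat_unit_carrier [simp]: "mat_unit m n k l \<in> carrier_mat m n"
  by (simp add: mat_unit_def)

text \<open>
  Products with a matrix unit in the middle isolate a product of single entries. This converts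
  statements about operators into statements about sums of matrix coefficients.
\<close>

lemma mat_mult_unit_mult_index:
  assumes "A \<in> carrier_mat p m" "B \<in> carrier_mat n q" "k < m" "l < n" "i < p" "j < q"
  shows "(A * mat_unit m n k l * B) $$ (i, j) = A $$ (i, k) * B $$ (l, j)"
proof -
  have *: "(A * mat_unit m n k l) $$ (i, b) = (if b = l then A $$ (i, k) else 0)" if "b < n" for b
    using assms that by (subst mat_mult_index[of _ p m _ n])
      (auto simp: mat_unit_def if_distrib cong: if_cong)
  have "(A * mat_unit m n k l * B) $$ (i, j) =
      (\<Sum>b<n. (if b = l then A $$ (i, k) else 0) * B $$ (b, j))"
    using assms by (subst mat_mult_index[of _ p n _ q]) (auto simp: * )
  also have "\<dots> = A $$ (i, k) * B $$ (l, j)"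
    using assms by (simp add: if_distribR if_distrib cong: if_cong)
  finally show ?thesis .
qed

lemma mat_trace_unit:
  assumes "k < n" "l < n"
  shows "mat_trace (mat_unit n n k l) = (if k = l then 1 else 0)"
  using assms by (auto simp: mat_trace_def mat_unit_def)

lemma mat_trace_unit_mult:
  assumes "B \<in> carrier_mat n m" "k < m" "l < n"
  shows "mat_trace (mat_unit m n k l * B) = B $$ (l, k)"
proof -
  have "mat_trace (mat_unit m n k l * B) = (\<Sum>i<m. \<Sum>j<n. (if i = k \<and> j = l then B $$ (j, i) else 0))"
    using assms by (subst mat_trace_mult[of _ m n]) (auto simp: mat_unit_def intro!: sum.cong)
  also have "\<dots> = (\<Sum>i<m. if i = k then B $$ (l, k) else 0)"
    using assms by (intro sum.cong refl) (auto intro: sum.neutral)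
  finally show ?thesis using assms by simp
qed

lemma mat_trace_mult_scalar:
  assumes "A \<in> carrier_mat n n"
  shows "mat_trace (A * (c \<cdot>\<^sub>m 1\<^sub>m n)) = c * mat_trace A"
  using assms by (simp add: mult_smult_distrib[OF assms one_carrier_mat] mat_trace_smult[OF assms])

section \<open>Subspaces in adapted coordinates\<close>

lemma mult_mat_zero_vec [simp]: "A \<in> carrier_mat m n \<Longrightarrow> A *\<^sub>v 0\<^sub>v n = (0\<^sub>v m :: complex vec)"
  by auto

lemma smult_one_mult_vec:
  assumes "v \<in> carrier_vec n"
  shows "(c \<cdot>\<^sub>m 1\<^sub>m n) *\<^sub>v v = c \<cdot>\<^sub>v (v :: complex vec)"
proof (rule eq_vecI)
  fix i assume "i < dim_vec (c \<cdot>\<^sub>v v)"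
  then have i: "i < n" using assms by simp
  then have "row (c \<cdot>\<^sub>m 1\<^sub>m n) i = c \<cdot>\<^sub>v unit_vec n i"
    by (intro eq_vecI) auto
  then show "((c \<cdot>\<^sub>m 1\<^sub>m n) *\<^sub>v v) $ i = (c \<cdot>\<^sub>v v) $ i"
    using i assms by (simp add: scalar_prod_left_unit)
qed (use assms in auto)

lemma nonzero_mat_moves_unit_vec:
  assumes "T \<in> carrier_mat m n" "T \<noteq> 0\<^sub>m m n"
  obtains j where "T *\<^sub>v unit_vec n j \<noteq> (0\<^sub>v m :: complex vec)"
proof -
  obtain i j where ij: "i < m" "j < n" "T $$ (i, j) \<noteq> 0"
    using assms by (metis carrier_matD eq_matI index_zero_mat)
  have "T *\<^sub>v unit_vec n j \<noteq> 0\<^sub>v m"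
  proof
    assume "T *\<^sub>v unit_vec n j = 0\<^sub>v m"
    moreover have "(T *\<^sub>v unit_vec n j) $ i = T $$ (i, j)"
      using ij carrier_matD[OF assms(1)] by simp
    ultimately show False using ij by simp
  qed
  then show thesis by (rule that)
qed

lemma mat_index_unit_vec:
  fixes M :: "complex mat"
  assumes "M \<in> carrier_mat m n" "i < m" "j < n"
  shows "M $$ (i, j) = (M *\<^sub>v unit_vec n j) $ i"
  using assms by auto

lemma mat_mult3_index:
  fixes Q M P :: "complex mat"
  assumes "Q \<in> carrier_mat n n" "M \<in> carrier_mat n n" "P \<in> carrier_mat n n" "i < n" "j < n"
  shows "(Q * M * P) $$ (i, j) = (Q *\<^sub>v (M *\<^sub>v (P *\<^sub>v unit_vec n j))) $ i"
proof -
  have QM: "Q * M \<in> carrier_mat n n" using assms by simp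
  have Pj: "P *\<^sub>v unit_vec n j \<in> carrier_vec n"
    by (rule mult_mat_vec_carrier[OF assms(3)]) simp
  have "(Q * M * P) $$ (i, j) = (Q * M * P *\<^sub>v unit_vec n j) $ i"
    using QM assms by (intro mat_index_unit_vec[of _ n n] mult_carrier_mat[of _ n n]) auto
  also have "Q * M * P *\<^sub>v unit_vec n j = Q * M *\<^sub>v (P *\<^sub>v unit_vec n j)"
    by (rule assoc_mult_mat_vec[OF QM assms(3)]) simp
  also have "\<dots> = Q *\<^sub>v (M *\<^sub>v (P *\<^sub>v unit_vec n j))"
    by (rule assoc_mult_mat_vec[OF assms(1,2) Pj])
  finally show ?thesis .
qed

lemma subspace_vecI:
  assumes "W \<subseteq> carrier_vec n" "0\<^sub>v n \<in> W"
    and "\<And>v w. v \<in> W \<Longrightarrow> w \<in> W \<Longrightarrow> v + w \<in> W"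
    and "\<And>(c::complex) v. v \<in> W \<Longrightarrow> c \<cdot>\<^sub>v v \<in> W"
  shows "subspace class_ring W (module_vec TYPE(complex) n)"
proof -
  have "submodule class_ring W (module_vec TYPE(complex) n)"
    unfolding submodule_def using assms vec_module[of n]
    by (auto simp: module_vec_simps)
  then show ?thesis using vec_vs unfolding subspace_def by blast
qed

text \<open>
  A basis of \<open>W\<close> is completed to a basis of the whole space by the replacement theorem. The
  columns of \<open>P\<close> are this basis, with the vectors of \<open>W\<close> first, so that \<open>Q\<close> computes coordinates
  with respect to it.
\<close>

lemma adapted_basis:
  assumes W: "subspace class_ring W (module_vec TYPE(complex) n)"
  defines "k \<equiv> vectorspace.dim class_ring ((module_vec TYPE(complex) n)\<lparr>carrier := W\<rparr>)"
  obtains P Q where "P \<in> carrier_mat n n" "Q \<in> carrier_mat n n" "P * Q = 1\<^sub>m n" "Q * P = 1\<^sub>m n"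
    "k \<le> n" "\<And>v. v \<in> carrier_vec n \<Longrightarrow> v \<in> W \<longleftrightarrow> (\<forall>i. k \<le> i \<longrightarrow> i < n \<longrightarrow> (Q *\<^sub>v v) $ i = 0)"
proof -
  interpret V: vec_space "TYPE(complex)" n .
  from V.subspace_is_vs[OF W] interpret W: vectorspace class_ring "V.vs W" .
  from W have sub: "submodule class_ring W V.V" by (simp add: subspace_def)
  then have WV: "W \<subseteq> carrier_vec n" by (simp add: submodule_def)
  have li: "finite A \<and> card A \<le> V.dim" if "A \<subseteq> W \<and> W.lin_indpt A" for A
    using V.span_li_not_depend(2)[OF _ sub, of A] that V.li_le_dim[OF V.fin_dim, of A] WV by auto
  have "\<exists>A. finite A \<and> maximal A (\<lambda>S. S\<subseteq>carrier (V.vs W) \<and> W.lin_indpt S)"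
    using li by (intro maximal_exists[where ?N="V.dim" and ?B="{}"]) (auto simp: W.lin_dep_def)
  then obtain A where finA: "finite A" and "maximal A (\<lambda>S. S\<subseteq>carrier (V.vs W) \<and> W.lin_indpt S)"
    by blast
  then have bas: "W.basis A" by (intro W.max_li_is_basis)
  then have AW: "A \<subseteq> W" and Ali: "W.lin_indpt A" and Aspan: "W.span A = W" 
    by (auto simp: W.basis_def)
  have cardA: "card A = k" unfolding k_def using W.dim_basis[OF finA bas] by simp
  have spanA: "V.span A = W" using V.span_li_not_depend(1)[OF AW sub] Aspan by simp
  have liA: "V.lin_indpt A" using V.span_li_not_depend(2)[OF AW sub] Ali by simp
  let ?B = "set (unit_vecs n) :: complex vec set"
  have cardB: "card ?B = n" using distinct_card[OF V.unit_vecs_distinct] by simp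
  obtain C where C: "finite C" "C \<subseteq> carrier_vec n" "C \<inter> A = {}"
     "int (card C) \<le> int (card ?B) - int (card A)" "V.span (A \<union> C) = V.span ?B"
    using V.replacement[OF finA _ _ liA, of ?B] AW WV V.unit_vecs_basis
    unfolding V.basis_def by auto
  from finA obtain as where as: "set as = A" "distinct as" using finite_distinct_list by blast
  from C(1) obtain cs where cs: "set cs = C" "distinct cs" using finite_distinct_list by blast
  have span: "V.span (set (as @ cs)) = carrier_vec n"
    using C(5) as cs V.span_unit_vecs_is_carrier by simp
  have carr: "set (as @ cs) \<subseteq> carrier_vec n" using as cs C AW WV by auto
  \<comment> \<open>A generating family has at least \<open>n\<close> members, and replacement bounds the size from above.\<close>
  have "n \<le> card (set (as @ cs))"
    using V.gen_ge_dim[OF _ carr] span V.dim_is_n by simp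
  moreover have "card (set (as @ cs)) = length as + length cs"
    using as cs C(3) by (subst distinct_card) auto
  moreover have las: "length as = k" using as cardA distinct_card by metis
  moreover have "length cs = card C" using cs distinct_card by metis
  ultimately have len: "length (as @ cs) = n" "k \<le> n" using C(4) cardA cardB by auto
  define P where "P = mat_of_cols n (as @ cs)"
  have P: "P \<in> carrier_mat n n" unfolding P_def using len by (metis mat_of_cols_carrier(1))
  have comb: "V.lincomb_list c (as @ cs) = P *\<^sub>v vec n c" for c
  proof -
    have "\<forall>w\<in>set (as @ cs). dim_vec w = n" using carr by auto
    then show ?thesis unfolding P_def using V.lincomb_list_as_mat_mult[of "as @ cs" c] len by simp
  qed
  have ex: "\<exists>c. P *\<^sub>v vec n c = v" if "v \<in> carrier_vec n" for v
  proof -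
    have "v \<in> V.span_list (as @ cs)" using that span V.span_list_as_span[OF carr] by simp
    then show ?thesis unfolding V.span_list_def comb by blast
  qed
  then have "\<forall>j. \<exists>c. P *\<^sub>v vec n c = unit_vec n j" by simp
  then obtain c where c: "P *\<^sub>v vec n (c j) = unit_vec n j" for j by metis
  define Q where "Q = mat n n (\<lambda>(i, j). c j i)"
  have Q: "Q \<in> carrier_mat n n" by (simp add: Q_def)
  have PQ: "P * Q = 1\<^sub>m n"
  proof (rule mat_col_eqI)
    fix j assume "j < dim_col (1\<^sub>m n :: complex mat)"
    then have j: "j < n" by simp
    have "col Q j = vec n (c j)" unfolding Q_def using j by (intro eq_vecI) auto
    then show "col (P * Q) j = col (1\<^sub>m n) j"
      unfolding col_mult2[OF P Q j] col_one[OF j] using c[of j] by simp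
  qed (use P Q in auto)
  have QP: "Q * P = 1\<^sub>m n" by (rule mat_mult_left_right_inverse[OF P Q PQ])
  have QPv: "Q *\<^sub>v (P *\<^sub>v v) = v" if "v \<in> carrier_vec n" for v
    using that P Q QP by (simp flip: assoc_mult_mat_vec[of Q n n P n])
  have PQv: "P *\<^sub>v (Q *\<^sub>v v) = v" if "v \<in> carrier_vec n" for v
    using that P Q PQ by (simp flip: assoc_mult_mat_vec[of P n n Q n])
  have Pas: "V.lincomb_list c as = P *\<^sub>v vec n c" if "\<And>i. k \<le> i \<Longrightarrow> i < n \<Longrightarrow> c i = 0" for c
  proof -
    have "set as \<subseteq> carrier_vec n" using carr by auto
    then have "\<forall>w\<in>set as. dim_vec w = n" by auto
    then have "V.lincomb_list c as = mat_of_cols n as *\<^sub>v vec k c"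
      using V.lincomb_list_as_mat_mult[of as c] las by simp
    also have "\<dots> = P *\<^sub>v vec n c"
    proof (rule eq_vecI)
      fix i assume "i < dim_vec (P *\<^sub>v vec n c)"
      then have i: "i < n" using P by simp
      have "(mat_of_cols n as *\<^sub>v vec k c) $ i = (\<Sum>j\<in>{0..<k}. as ! j $ i * c j)"
        using i las by (auto simp: scalar_prod_def mat_of_cols_def intro!: sum.cong)
      also have "\<dots> = (\<Sum>j\<in>{0..<k}. P $$ (i, j) * c j)"
        using i las len by (auto simp: P_def mat_of_cols_def nth_append intro!: sum.cong)
      also have "\<dots> = (\<Sum>j\<in>{0..<n}. P $$ (i, j) * c j)"
        using that len by (intro sum.mono_neutral_left) auto
      also have "\<dots> = (P *\<^sub>v vec n c) $ i"
        using i P by (auto simp: scalar_prod_def intro!: sum.cong)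
      finally show "(mat_of_cols n as *\<^sub>v vec k c) $ i = (P *\<^sub>v vec n c) $ i" .
    qed (use P in auto)
    finally show ?thesis .
  qed
  have Wchar: "v \<in> W \<longleftrightarrow> (\<exists>c. v = V.lincomb_list c as)" for v
    using spanA V.span_list_as_span[of as] as carr unfolding V.span_list_def by auto
  have "v \<in> W \<longleftrightarrow> (\<forall>i. k \<le> i \<longrightarrow> i < n \<longrightarrow> (Q *\<^sub>v v) $ i = 0)" if v: "v \<in> carrier_vec n" for v
  proof
    assume "v \<in> W"
    then obtain c where c: "v = V.lincomb_list c as" using Wchar by blast
    let ?c = "\<lambda>i. if i < k then c i else 0"
    have "v = V.lincomb_list ?c as" unfolding c V.lincomb_list_def las[symmetric]
      by (intro arg_cong[of _ _ V.sumlist]) auto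
    then have "v = P *\<^sub>v vec n ?c" using Pas[of ?c] by auto
    then have "Q *\<^sub>v v = vec n ?c" using QPv by auto
    then show "\<forall>i. k \<le> i \<longrightarrow> i < n \<longrightarrow> (Q *\<^sub>v v) $ i = 0" by auto
  next
    assume *: "\<forall>i. k \<le> i \<longrightarrow> i < n \<longrightarrow> (Q *\<^sub>v v) $ i = 0"
    have "vec n (\<lambda>i. (Q *\<^sub>v v) $ i) = Q *\<^sub>v v" using Q by (intro eq_vecI) auto
    then have "v = V.lincomb_list (\<lambda>i. (Q *\<^sub>v v) $ i) as"
      using Pas[of "\<lambda>i. (Q *\<^sub>v v) $ i"] * PQv[OF v] by auto
    then show "v \<in> W" using Wchar by blast
  qed
  then show thesis using that P Q PQ QP len(2) by blast
qed

text \<open>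
  In adapted coordinates the diagonal entries of \<open>S\<close> are \<open>c\<close> in the positions that belong to \<open>W\<close>, and
  zero in the others since the image lies in \<open>W\<close>.
\<close>

lemma trace_of_scaled_projection:
  assumes W: "subspace class_ring W (module_vec TYPE(complex) n)"
    and S: "S \<in> carrier_mat n n"
    and into: "\<And>v. v \<in> carrier_vec n \<Longrightarrow> S *\<^sub>v v \<in> W"
    and scale: "\<And>w. w \<in> W \<Longrightarrow> S *\<^sub>v w = c \<cdot>\<^sub>v w"
  shows "mat_trace S = c * of_nat (vectorspace.dim class_ring ((module_vec TYPE(complex) n)\<lparr>carrier := W\<rparr>))"
proof -
  let ?k = "vectorspace.dim class_ring ((module_vec TYPE(complex) n)\<lparr>carrier := W\<rparr>)"
  obtain P Q where P: "P \<in> carrier_mat n n" and Q: "Q \<in> carrier_mat n n"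
    and PQ: "P * Q = 1\<^sub>m n" "Q * P = 1\<^sub>m n" and k: "?k \<le> n"
    and mem: "\<And>v. v \<in> carrier_vec n \<Longrightarrow> v \<in> W \<longleftrightarrow> (\<forall>i. ?k \<le> i \<longrightarrow> i < n \<longrightarrow> (Q *\<^sub>v v) $ i = 0)"
    using adapted_basis[OF W] by blast
  have QSP: "Q * S * P \<in> carrier_mat n n" using P Q S by simp
  have diag: "(Q * S * P) $$ (i, i) = (if i < ?k then c else 0)" if i: "i < n" for i
  proof -
    let ?v = "P *\<^sub>v unit_vec n i"
    have v: "?v \<in> carrier_vec n" by (rule mult_mat_vec_carrier[OF P]) simp
    have Qv: "Q *\<^sub>v ?v = unit_vec n i"
      using assoc_mult_mat_vec[OF Q P, of "unit_vec n i"] PQ(2) by simp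
    have Sv: "S *\<^sub>v ?v \<in> carrier_vec n" by (rule mult_mat_vec_carrier[OF S v])
    show ?thesis
    proof (cases "i < ?k")
      case True
      then have "?v \<in> W" unfolding mem[OF v] Qv using i by auto
      then have "Q *\<^sub>v (S *\<^sub>v ?v) = c \<cdot>\<^sub>v unit_vec n i"
        using scale mult_mat_vec[OF Q v] Qv by simp
      then show ?thesis using True i by (simp add: mat_mult3_index[OF Q S P] del: index_mult_mat)
    next
      case False
      then show ?thesis using mem[OF Sv] into[OF v] i
        by (simp add: mat_mult3_index[OF Q S P] del: index_mult_mat)
    qed
  qed
  have "mat_trace S = mat_trace (Q * S * P)"
    by (rule mat_trace_similar[OF S P Q PQ(1), symmetric])
  also have "\<dots> = (\<Sum>i<n. if i < ?k then c else 0)"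
    using diag by (simp add: mat_trace_carrier[OF QSP] del: index_mult_mat)
  also have "\<dots> = (\<Sum>i<?k. c)"
    using k by (intro sum.mono_neutral_cong_right) auto
  finally show ?thesis by (simp add: mult.commute)
qed

lemma sum_lessThan_add:
  fixes f :: "nat \<Rightarrow> 'b :: comm_monoid_add"
  shows "(\<Sum>l<k + d. f l) = (\<Sum>l<k. f l) + (\<Sum>l<d. f (k + l))"
  by (induction d) (auto simp: ac_simps)

section \<open>Bilinear forms as matrices\<close>

text \<open>
  The vector is built up one coordinate at a time, by induction on the number of coordinates that
  have already been copied.
\<close>

lemma linear_functional_expand:
  fixes f :: "complex vec \<Rightarrow> complex"
  assumes add: "\<And>u v. u \<in> carrier_vec n \<Longrightarrow> v \<in> carrier_vec n \<Longrightarrow> f (u + v) = f u + f v"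
    and smult: "\<And>c v. v \<in> carrier_vec n \<Longrightarrow> f (c \<cdot>\<^sub>v v) = c * f v"
    and v: "v \<in> carrier_vec n"
  shows "f v = (\<Sum>i<n. v $ i * f (unit_vec n i))"
proof -
  define p where "p k = vec n (\<lambda>i. if i < k then v $ i else 0)" for k
  have "k \<le> n \<Longrightarrow> f (p k) = (\<Sum>i<k. v $ i * f (unit_vec n i))" for k
  proof (induction k)
    case 0
    \<comment> \<open>Additivity alone does not mention the zero vector; homogeneity with factor \<open>0\<close> does.\<close>
    have "p 0 = 0 \<cdot>\<^sub>v (0\<^sub>v n)" by (auto simp: p_def)
    then show ?case using smult[of "0\<^sub>v n" 0] by simp
  next
    case (Suc k)
    have "p (Suc k) = p k + v $ k \<cdot>\<^sub>v unit_vec n k"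
      using Suc.prems by (intro eq_vecI) (auto simp: p_def less_Suc_eq)
    moreover have "p k \<in> carrier_vec n" by (simp add: p_def)
    ultimately show ?case using Suc by (simp add: add smult)
  qed
  moreover have "p n = v" using v by (auto simp: p_def)
  ultimately show ?thesis by auto
qed

lemma bilinear_form_matrix:
  assumes B: "bilinear_form n B"
  defines "M \<equiv> mat n n (\<lambda>(i, j). B (unit_vec n i) (unit_vec n j))"
  assumes v: "v \<in> carrier_vec n" and w: "w \<in> carrier_vec n"
  shows "B v w = v \<bullet> (M *\<^sub>v w)"
proof -
  have *: "B x w = (\<Sum>j<n. w $ j * B x (unit_vec n j))" if "x \<in> carrier_vec n" for x
    using B that w by (intro linear_functional_expand) (auto simp: bilinear_form_def)
  have "B v w = (\<Sum>i<n. v $ i * B (unit_vec n i) w)"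
    using B v w by (intro linear_functional_expand[where f = "\<lambda>x. B x w"]) (auto simp: bilinear_form_def)
  also have "\<dots> = (\<Sum>i<n. v $ i * (M *\<^sub>v w) $ i)"
  proof (intro sum.cong refl arg_cong2[of _ _ _ _ times])
    fix i assume "i \<in> {..<n}"
    then show "B (unit_vec n i) w = (M *\<^sub>v w) $ i" using w
      by (subst * ) (auto simp: M_def scalar_prod_def lessThan_atLeast0 mult.commute intro!: sum.cong)
  qed
  finally show ?thesis by (simp add: scalar_prod_def M_def lessThan_atLeast0)
qed

lemma zero_mat_mult_vec: "w \<in> carrier_vec n \<Longrightarrow> 0\<^sub>m m n *\<^sub>v w = (0\<^sub>v m :: complex vec)"
  by (auto simp: scalar_prod_def)

lemma mat_eq_by_scalar_prod:
  fixes M N :: "complex mat"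
  assumes M: "M \<in> carrier_mat n n" and N: "N \<in> carrier_mat n n"
    and eq: "\<And>v w. v \<in> carrier_vec n \<Longrightarrow> w \<in> carrier_vec n \<Longrightarrow> v \<bullet> (M *\<^sub>v w) = v \<bullet> (N *\<^sub>v w)"
  shows "M = N"
proof (rule eq_matI)
  fix i j assume "i < dim_row N" "j < dim_col N"
  then have ij: "i < n" "j < n" using N by auto
  have "unit_vec n i \<bullet> (A *\<^sub>v unit_vec n j) = A $$ (i, j)" if "A \<in> carrier_mat n n" for A :: "complex mat"
  proof -
    have "A *\<^sub>v unit_vec n j \<in> carrier_vec n" by (rule mult_mat_vec_carrier[OF that]) simp
    then have "unit_vec n i \<bullet> (A *\<^sub>v unit_vec n j) = (A *\<^sub>v unit_vec n j) $ i"
      using ij(1) by (rule scalar_prod_left_unit)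
    then show ?thesis using mat_index_unit_vec[OF that ij] by simp
  qed
  from this[OF M] this[OF N] eq[of "unit_vec n i" "unit_vec n j"]
  show "M $$ (i, j) = N $$ (i, j)" by simp
qed (use M N in auto)

lemma scalar_prod_mult_mat_left:
  fixes A :: "complex mat"
  assumes A: "A \<in> carrier_mat n n" and v: "v \<in> carrier_vec n" and w: "w \<in> carrier_vec n"
  shows "(A *\<^sub>v v) \<bullet> w = v \<bullet> (transpose_mat A *\<^sub>v w)"
proof -
  have Av: "A *\<^sub>v v \<in> carrier_vec n" by (rule mult_mat_vec_carrier[OF A v])
  have Aw: "transpose_mat A *\<^sub>v w \<in> carrier_vec n"
    using A w by (intro mult_mat_vec_carrier[of _ n n]) auto
  show ?thesis
    using transpose_vec_mult_scalar[OF A v w] comm_scalar_prod[OF Aw v] comm_scalar_prod[OF Av w] by simp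
qed

section \<open>Representations and Schur's lemma\<close>

abbreviation chi :: "'a rep \<Rightarrow> 'a \<Rightarrow> complex" where
  "chi \<pi> g \<equiv> mat_trace (snd \<pi> g)"

locale finite_group = group G for G (structure) +
  assumes finite_carrier: "finite (carrier G)"
begin

text \<open>
  A multiplicative family with \<open>\<rho> \<one> = 1\<close> has invertible values, since \<open>\<rho> (inv g)\<close> inverts
  \<open>\<rho> g\<close>.
\<close>

lemma repI:
  assumes "\<And>g. g \<in> carrier G \<Longrightarrow> \<rho> g \<in> carrier_mat n n"
    and "\<And>g h. g \<in> carrier G \<Longrightarrow> h \<in> carrier G \<Longrightarrow> \<rho> (g \<otimes> h) = \<rho> g * \<rho> h"
    and "\<rho> \<one> = 1\<^sub>m n"
  shows "is_rep G (n, \<rho>)"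
proof -
  have "\<rho> g \<in> Units (ring_mat TYPE(complex) n ())" if "g \<in> carrier G" for g
  proof -
    have "\<rho> (inv g) * \<rho> g = 1\<^sub>m n" "\<rho> g * \<rho> (inv g) = 1\<^sub>m n"
      using that assms(2)[of "inv g" g] assms(2)[of g "inv g"] assms(3) by auto
    then show ?thesis using assms(1) that by (auto simp: Units_def ring_mat_simps)
  qed
  then show ?thesis using assms(2) by (auto simp: is_rep_def hom_def units_of_def ring_mat_simps)
qed

context
  fixes \<pi> :: "'a rep"
  assumes rep: "is_rep G \<pi>"
begin

lemma rep_carrier [simp]: "g \<in> carrier G \<Longrightarrow> snd \<pi> g \<in> carrier_mat (fst \<pi>) (fst \<pi>)"
  using rep by (auto simp: is_rep_def hom_def units_of_def Units_def ring_mat_simps)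

lemma rep_dim [simp]:
  "g \<in> carrier G \<Longrightarrow> dim_row (snd \<pi> g) = fst \<pi>" "g \<in> carrier G \<Longrightarrow> dim_col (snd \<pi> g) = fst \<pi>"
  using rep_carrier carrier_matD by blast+

lemma rep_mult:
  "g \<in> carrier G \<Longrightarrow> h \<in> carrier G \<Longrightarrow> snd \<pi> (g \<otimes> h) = snd \<pi> g * snd \<pi> h"
  using rep by (auto simp: is_rep_def hom_def units_of_def ring_mat_simps)

lemma rep_one: "snd \<pi> \<one> = 1\<^sub>m (fst \<pi>)"
proof -
  let ?n = "fst \<pi>"
  have "snd \<pi> \<one> \<in> Units (ring_mat TYPE(complex) ?n ())"
    using rep by (auto simp: is_rep_def hom_def units_of_def)
  then obtain B where B: "B \<in> carrier_mat ?n ?n" "B * snd \<pi> \<one> = 1\<^sub>m ?n"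
    by (auto simp: Units_def ring_mat_simps)
  \<comment> \<open>An invertible idempotent is the identity.\<close>
  have "snd \<pi> \<one> = (B * snd \<pi> \<one>) * snd \<pi> \<one>" using B by simp
  also have "\<dots> = B * (snd \<pi> \<one> * snd \<pi> \<one>)" using B by (intro assoc_mult_mat) auto
  also have "\<dots> = 1\<^sub>m ?n" using rep_mult[of \<one> \<one>] B by simp
  finally show ?thesis .
qed

lemma rep_inv_mult:
  "g \<in> carrier G \<Longrightarrow> snd \<pi> g * snd \<pi> (inv g) = 1\<^sub>m (fst \<pi>)"
  "g \<in> carrier G \<Longrightarrow> snd \<pi> (inv g) * snd \<pi> g = 1\<^sub>m (fst \<pi>)"
  by (simp_all flip: rep_mult add: rep_one)

lemma chi_mult_commute:
  "g \<in> carrier G \<Longrightarrow> h \<in> carrier G \<Longrightarrow> chi \<pi> (g \<otimes> h) = chi \<pi> (h \<otimes> g)"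
  by (simp add: rep_mult mat_trace_mult_commute[of _ "fst \<pi>" "fst \<pi>"])

lemma chi_one: "chi \<pi> \<one> = of_nat (fst \<pi>)"
  by (simp add: rep_one mat_trace_one)

end

lemma irreducible_repD: "irreducible_rep G \<pi> \<Longrightarrow> is_rep G \<pi>" "irreducible_rep G \<pi> \<Longrightarrow> fst \<pi> > 0"
  by (auto simp: irreducible_rep_def)

lemma irreducible_repD_subspace:
  assumes "irreducible_rep G \<pi>" "W \<subseteq> carrier_vec (fst \<pi>)" "0\<^sub>v (fst \<pi>) \<in> W"
    and "\<And>v w. v \<in> W \<Longrightarrow> w \<in> W \<Longrightarrow> v + w \<in> W"
    and "\<And>(c::complex) v. v \<in> W \<Longrightarrow> c \<cdot>\<^sub>v v \<in> W"
    and "\<And>g v. g \<in> carrier G \<Longrightarrow> v \<in> W \<Longrightarrow> snd \<pi> g *\<^sub>v v \<in> W"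
  shows "W = {0\<^sub>v (fst \<pi>)} \<or> W = carrier_vec (fst \<pi>)"
  using assms subspace_vecI[of W "fst \<pi>"] by (auto simp: irreducible_rep_def)

definition intertwines :: "'a rep \<Rightarrow> 'a rep \<Rightarrow> complex mat \<Rightarrow> bool" where
  "intertwines \<pi> \<tau> T \<longleftrightarrow> T \<in> carrier_mat (fst \<tau>) (fst \<pi>) \<and>
     (\<forall>g\<in>carrier G. T * snd \<pi> g = snd \<tau> g * T)"

lemma intertwines_vec:
  assumes "is_rep G \<pi>" "is_rep G \<tau>" "intertwines \<pi> \<tau> T" "g \<in> carrier G" "v \<in> carrier_vec (fst \<pi>)"
  shows "T *\<^sub>v (snd \<pi> g *\<^sub>v v) = snd \<tau> g *\<^sub>v (T *\<^sub>v v)"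
proof -
  have T: "T \<in> carrier_mat (fst \<tau>) (fst \<pi>)" "T * snd \<pi> g = snd \<tau> g * T"
    using assms(3,4) by (auto simp: intertwines_def)
  show ?thesis
    using T(2) assoc_mult_mat_vec[OF T(1) rep_carrier[OF assms(1,4)] assms(5)]
      assoc_mult_mat_vec[OF rep_carrier[OF assms(2,4)] T(1) assms(5)] by simp
qed

text \<open>
  The kernel of an intertwiner is invariant under \<open>\<pi>\<close>. The target is an arbitrary
  representation, so that \<open>\<pi>\<^sup>* \<circ> \<theta>\<close> is covered.
\<close>

lemma schur_injective:
  assumes \<pi>: "irreducible_rep G \<pi>" and \<tau>: "is_rep G \<tau>" and T: "intertwines \<pi> \<tau> T"
    and nz: "T \<noteq> 0\<^sub>m (fst \<tau>) (fst \<pi>)"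
  shows "{v \<in> carrier_vec (fst \<pi>). T *\<^sub>v v = 0\<^sub>v (fst \<tau>)} = {0\<^sub>v (fst \<pi>)}"
proof -
  define n m where "n = fst \<pi>" and "m = fst \<tau>"
  note rep = irreducible_repD(1)[OF \<pi>] \<tau>
  have Tc: "T \<in> carrier_mat m n" using T by (auto simp: intertwines_def m_def n_def)
  obtain j where Tnz: "T *\<^sub>v unit_vec n j \<noteq> 0\<^sub>v m"
    using nonzero_mat_moves_unit_vec[OF Tc] nz unfolding n_def m_def by blast
  have "{v \<in> carrier_vec n. T *\<^sub>v v = 0\<^sub>v m} = {0\<^sub>v n} \<or> {v \<in> carrier_vec n. T *\<^sub>v v = 0\<^sub>v m} = carrier_vec n"
    unfolding n_def
  proof (rule irreducible_repD_subspace[OF \<pi>], goal_cases)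
    case (5 g v)
    then show ?case
      using intertwines_vec[OF rep T, of g v] rep_carrier[OF rep(1), of g] rep_carrier[OF rep(2), of g]
      by (auto simp: n_def[symmetric] m_def[symmetric])
  qed (use Tc in \<open>auto simp: n_def[symmetric] mult_add_distrib_mat_vec[of T m n] mult_mat_vec[of T m n]\<close>)
  then show ?thesis
    using Tnz unfolding n_def m_def by (metis (mono_tags, lifting) mem_Collect_eq unit_vec_carrier)
qed

lemma schur_invertible:
  assumes \<pi>: "irreducible_rep G \<pi>" and \<tau>: "is_rep G \<tau>" and T: "intertwines \<pi> \<tau> T"
    and nz: "T \<noteq> 0\<^sub>m (fst \<tau>) (fst \<pi>)" and dim: "fst \<tau> = fst \<pi>"
  obtains S where "S \<in> carrier_mat (fst \<pi>) (fst \<pi>)" "T * S = 1\<^sub>m (fst \<pi>)" "S * T = 1\<^sub>m (fst \<pi>)"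
proof -
  have Tc: "T \<in> carrier_mat (fst \<pi>) (fst \<pi>)" using T dim by (simp add: intertwines_def)
  have "det T \<noteq> 0"
    unfolding det_0_iff_vec_prod_zero_field[OF Tc] using schur_injective[OF \<pi> \<tau> T nz] dim by auto
  from det_non_zero_imp_unit[OF Tc this, of "()"] show thesis
    using that by (auto simp: Units_def ring_mat_simps)
qed

text \<open>
  The kernel is zero and the image, being invariant under \<open>\<tau>\<close>, is everything. Preimages of the
  unit vectors are the columns of an inverse.
\<close>

lemma schur:
  assumes \<pi>: "irreducible_rep G \<pi>" and \<tau>: "irreducible_rep G \<tau>" and T: "intertwines \<pi> \<tau> T"
    and nz: "T \<noteq> 0\<^sub>m (fst \<tau>) (fst \<pi>)"
  shows "fst \<pi> = fst \<tau>" "invertible_mat T"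
proof -
  define n m where "n = fst \<pi>" and "m = fst \<tau>"
  note rep = irreducible_repD(1)[OF \<pi>] irreducible_repD(1)[OF \<tau>]
  have Tc [simp]: "T \<in> carrier_mat m n"
    using T by (auto simp: intertwines_def m_def n_def)
  note Tgv = intertwines_vec[OF rep T]
  obtain j where Tnz: "T *\<^sub>v unit_vec n j \<noteq> 0\<^sub>v m"
    using nonzero_mat_moves_unit_vec[OF Tc] nz unfolding n_def m_def by blast
  have inj: "{v \<in> carrier_vec n. T *\<^sub>v v = 0\<^sub>v m} = {0\<^sub>v n}"
    using schur_injective[OF \<pi> rep(2) T nz] by (simp add: n_def m_def)
  let ?im = "(\<lambda>v. T *\<^sub>v v) ` carrier_vec n"
  have "?im = {0\<^sub>v m} \<or> ?im = carrier_vec m"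
    unfolding m_def
  proof (rule irreducible_repD_subspace[OF \<tau>], goal_cases)
    case (3 v w)
    then show ?case by (auto simp: mult_add_distrib_mat_vec[of T m n, symmetric])
  next
    case (4 c v)
    then show ?case by (auto simp: mult_mat_vec[of T m n, symmetric])
  next
    case (5 g v)
    then show ?case using Tgv[of g, symmetric] rep_carrier[OF rep(1), of g]
      by (auto simp: n_def[symmetric])
  qed (use mult_mat_vec_carrier[OF Tc] mult_mat_zero_vec[OF Tc, symmetric]
      in \<open>auto simp: m_def[symmetric] intro!: image_eqI[of _ _ "0\<^sub>v n"]\<close>)
  then have "?im = carrier_vec m" using Tnz by (metis image_eqI singletonD unit_vec_carrier)
  then have "\<exists>v\<in>carrier_vec n. T *\<^sub>v v = unit_vec m a" for a
    by (metis imageE unit_vec_carrier)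
  then obtain s where s: "s a \<in> carrier_vec n" "T *\<^sub>v s a = unit_vec m a" for a by metis
  define S where "S = mat n m (\<lambda>(b, a). s a $ b)"
  have S [simp]: "S \<in> carrier_mat n m" by (simp add: S_def)
  have colS: "col S a = s a" if "a < m" for a
    using s(1)[of a] that by (intro eq_vecI) (auto simp: S_def)
  have TS: "T * S = 1\<^sub>m m"
  proof (rule mat_col_eqI)
    fix a assume "a < dim_col (1\<^sub>m m :: complex mat)"
    then show "col (T * S) a = col (1\<^sub>m m) a"
      using s(2) by (simp add: col_mult2[of T m n S m] colS)
  qed (use carrier_matD[OF Tc] carrier_matD[OF S] in auto)
  have ST: "S * T = 1\<^sub>m n"
  proof (rule mat_col_eqI)
    fix b assume "b < dim_col (1\<^sub>m n :: complex mat)"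
    then have b: "b < n" by simp
    let ?v = "S *\<^sub>v col T b"
    have "T *\<^sub>v ?v = col T b" using Tc S TS b
      by (simp flip: assoc_mult_mat_vec[of T m n S m])
    moreover have "T *\<^sub>v unit_vec n b = col T b"
      using carrier_matD[OF Tc] b by (intro eq_vecI) auto
    moreover have vc: "?v \<in> carrier_vec n" using S Tc by (meson mult_mat_vec_carrier col_carrier_vec b)
    ultimately have "T *\<^sub>v (?v - unit_vec n b) = 0\<^sub>v m"
      using mult_minus_distrib_mat_vec[OF Tc vc, of "unit_vec n b"] minus_cancel_vec[of "col T b" m]
        col_carrier_vec[OF b, of T m] by simp
    with vc have "?v - unit_vec n b \<in> {v \<in> carrier_vec n. T *\<^sub>v v = 0\<^sub>v m}" by auto
    then have z: "?v - unit_vec n b = 0\<^sub>v n" using inj by simp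
    have "?v = unit_vec n b"
    proof (rule eq_vecI)
      fix i assume "i < dim_vec (unit_vec n b :: complex vec)"
      then have "(?v - unit_vec n b) $ i = 0" using z by simp
      then show "?v $ i = unit_vec n b $ i" using \<open>i < _\<close> vc by simp
    qed (use carrier_matD[OF S] in simp)
    then show "col (S * T) b = col (1\<^sub>m n) b" using b by (simp add: col_mult2[of S n m T n])
  qed (use carrier_matD[OF Tc] carrier_matD[OF S] in auto)
  have mn: "m = n" by (rule two_sided_inverse_imp_square[OF Tc S TS ST])
  then show "fst \<pi> = fst \<tau>" by (simp add: m_def n_def)
  show "invertible_mat T" using invertible_matI[of T n S] mn Tc S TS ST by simp
qed

lemma schur_iso:
  assumes "irreducible_rep G \<pi>" "irreducible_rep G \<tau>" "intertwines \<pi> \<tau> T" "\<not> rep_iso G \<pi> \<tau>"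
  shows "T = 0\<^sub>m (fst \<tau>) (fst \<pi>)"
  using schur[OF assms(1-3)] assms(3,4) unfolding rep_iso_def intertwines_def by blast

text \<open>
  Over the complex numbers \<open>T\<close> has an eigenvalue \<open>c\<close>. The intertwiner \<open>T - c\<close> is not invertible, so
  it is zero.
\<close>

lemma schur_scalar:
  assumes \<pi>: "irreducible_rep G \<pi>" and T: "intertwines \<pi> \<pi> T"
  obtains c where "T = c \<cdot>\<^sub>m 1\<^sub>m (fst \<pi>)"
proof -
  define n where "n = fst \<pi>"
  note rep = irreducible_repD(1)[OF \<pi>]
  have Tc [simp]: "T \<in> carrier_mat n n" and
    Tg: "\<And>g. g \<in> carrier G \<Longrightarrow> T * snd \<pi> g = snd \<pi> g * T"
    using T by (auto simp: intertwines_def n_def)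
  have n: "n > 0" using irreducible_repD(2)[OF \<pi>] by (simp add: n_def)
  obtain c where "eigenvalue T c"
    using spectrum_non_empty[OF Tc n] by (auto simp: spectrum_def)
  then obtain v where v: "v \<in> carrier_vec n" "v \<noteq> 0\<^sub>v n" "T *\<^sub>v v = c \<cdot>\<^sub>v v"
    using Tc by (auto simp: eigenvalue_def eigenvector_def)
  define S where "S = T - c \<cdot>\<^sub>m 1\<^sub>m n"
  have S [simp]: "S \<in> carrier_mat n n" by (simp add: S_def minus_carrier_mat)
  have "S * snd \<pi> g = snd \<pi> g * S" if g: "g \<in> carrier G" for g
    using rep_carrier[OF rep g] Tg[OF g] unfolding S_def
    by (simp add: n_def[symmetric] minus_mult_distrib_mat[of _ n n _ _ n] mult_minus_distrib_mat[of _ n n _ n]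
        mult_smult_assoc_mat[of _ n n _ n] mult_smult_distrib[of _ n n _ n])
  then have int: "intertwines \<pi> \<pi> S" using S by (simp add: intertwines_def n_def)
  have "S = 0\<^sub>m n n"
  proof (rule ccontr)
    assume "S \<noteq> 0\<^sub>m n n"
    then have "invertible_mat S" using schur(2)[OF \<pi> \<pi> int] by (simp add: n_def)
    then obtain B where B: "B \<in> carrier_mat n n" "B * S = 1\<^sub>m n" using S by (rule invertible_matE) auto
    have "S *\<^sub>v v = T *\<^sub>v v - (c \<cdot>\<^sub>m 1\<^sub>m n) *\<^sub>v v" unfolding S_def using v
      by (intro minus_mult_distrib_mat_vec[of _ n n]) auto
    also have "\<dots> = 0\<^sub>v n" using v by (simp add: smult_one_mult_vec)
    finally have "B *\<^sub>v (S *\<^sub>v v) = 0\<^sub>v n" using B by auto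
    then have "v = 0\<^sub>v n" using B v by (simp flip: assoc_mult_mat_vec[of B n n S n])
    with v show False by simp
  qed
  then have "T = c \<cdot>\<^sub>m 1\<^sub>m n"
  proof -
    have "T $$ (i, j) = (c \<cdot>\<^sub>m 1\<^sub>m n) $$ (i, j)" if "i < n" "j < n" for i j
    proof -
      have "S $$ (i, j) = 0" using \<open>S = 0\<^sub>m n n\<close> that by simp
      then show ?thesis using that by (simp add: S_def)
    qed
    then show ?thesis using carrier_matD[OF Tc] by (intro eq_matI) auto
  qed
  then show thesis using that by (simp add: n_def)
qed

section \<open>Orthogonality relations\<close>

lemma bij_mult_left: "y \<in> carrier G \<Longrightarrow> bij_betw (\<lambda>g. y \<otimes> g) (carrier G) (carrier G)"
  by (rule bij_betwI[of _ _ _ "\<lambda>g. inv y \<otimes> g"]) (auto simp flip: m_assoc)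

lemma bij_mult_right: "y \<in> carrier G \<Longrightarrow> bij_betw (\<lambda>g. g \<otimes> y) (carrier G) (carrier G)"
  by (rule bij_betwI[of _ _ _ "\<lambda>g. g \<otimes> inv y"]) (auto simp: m_assoc)

lemma bij_inv: "bij_betw (\<lambda>g. inv g) (carrier G) (carrier G)"
  by (rule bij_betwI[of _ _ _ "\<lambda>g. inv g"]) auto

lemma order_pos: "card (carrier G) > 0"
  using finite_carrier one_closed by (auto simp: card_gt_0_iff)

text \<open>
  Averaging an arbitrary matrix over the group (up to the factor \<open>|G|\<close>) makes it an intertwiner.
  All orthogonality relations below evaluate this intertwiner by Schur's lemma.
\<close>

definition transfer :: "'a rep \<Rightarrow> 'a rep \<Rightarrow> complex mat \<Rightarrow> complex mat" where
  "transfer \<pi> \<tau> M = mat_sum (fst \<tau>) (fst \<pi>) (\<lambda>g. snd \<tau> g * M * snd \<pi> (inv g)) (carrier G)"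

lemma transfer_intertwines:
  assumes \<pi>: "is_rep G \<pi>" and \<tau>: "is_rep G \<tau>" and M: "M \<in> carrier_mat (fst \<tau>) (fst \<pi>)"
  shows "intertwines \<pi> \<tau> (transfer \<pi> \<tau> M)"
  unfolding intertwines_def
proof (intro conjI ballI)
  define n m where "n = fst \<pi>" and "m = fst \<tau>"
  fix y assume y: "y \<in> carrier G"
  let ?F = "\<lambda>g. snd \<tau> g * M * snd \<pi> (inv g)"
  have c: "\<And>g. g \<in> carrier G \<Longrightarrow> snd \<pi> g \<in> carrier_mat n n" "\<And>g. g \<in> carrier G \<Longrightarrow> snd \<tau> g \<in> carrier_mat m m"
     "M \<in> carrier_mat m n"
    using \<pi> \<tau> M by (simp_all add: n_def m_def)
  have F: "?F g \<in> carrier_mat m n" if "g \<in> carrier G" for g using c that by (intro mult_carrier_mat) auto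
  have "transfer \<pi> \<tau> M * snd \<pi> y = mat_sum m n (\<lambda>g. ?F g * snd \<pi> y) (carrier G)"
    unfolding transfer_def n_def[symmetric] m_def[symmetric]
    using c F y by (intro mat_sum_mult) auto
  also have "\<dots> = mat_sum m n (\<lambda>g. ?F (y \<otimes> g) * snd \<pi> y) (carrier G)"
    by (rule mat_sum_reindex[OF bij_mult_left[OF y], symmetric])
  also have "\<dots> = mat_sum m n (\<lambda>g. snd \<tau> y * ?F g) (carrier G)"
  proof (rule mat_sum_cong)
    fix g assume g: "g \<in> carrier G"
    have 1: "snd \<pi> (inv g) * snd \<pi> (inv y) * snd \<pi> y = snd \<pi> (inv g)"
      using g y c rep_inv_mult(2)[OF \<pi> y]
      by (simp add: assoc_mult_mat[of _ n n _ n _ n] n_def[symmetric] right_mult_one_mat[of _ n n])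
    have "?F (y \<otimes> g) * snd \<pi> y = snd \<tau> y * snd \<tau> g * M * (snd \<pi> (inv g) * snd \<pi> (inv y)) * snd \<pi> y"
      using g y by (simp add: inv_mult_group rep_mult[OF \<pi>] rep_mult[OF \<tau>])
    also have "\<dots> = snd \<tau> y * snd \<tau> g * M * (snd \<pi> (inv g) * snd \<pi> (inv y) * snd \<pi> y)"
      using g y c by (intro assoc_mult_mat[of _ m n _ n _ n] mult_carrier_mat[of _ _ n] mult_carrier_mat[of _ m m]) auto
    also have "\<dots> = snd \<tau> y * ?F g"
    proof -
      have "snd \<tau> g * M \<in> carrier_mat m n" using g c by (intro mult_carrier_mat) auto
      then show ?thesis unfolding 1 using g y c
        by (simp add: assoc_mult_mat[of _ m m _ m _ n] assoc_mult_mat[of "snd \<tau> y" m m _ n _ n])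
    qed
    finally show "?F (y \<otimes> g) * snd \<pi> y = snd \<tau> y * ?F g" .
  qed
  also have "\<dots> = snd \<tau> y * transfer \<pi> \<tau> M"
    unfolding transfer_def n_def[symmetric] m_def[symmetric]
    using c F y by (intro mult_mat_sum[symmetric]) auto
  finally show "transfer \<pi> \<tau> M * snd \<pi> y = snd \<tau> y * transfer \<pi> \<tau> M" .
qed (simp add: transfer_def)

lemma intertwiner_scalar_by_trace:
  assumes \<pi>: "irreducible_rep G \<pi>" and T: "intertwines \<pi> \<pi> T"
  shows "T = (mat_trace T / of_nat (fst \<pi>)) \<cdot>\<^sub>m 1\<^sub>m (fst \<pi>)"
proof -
  obtain c where c: "T = c \<cdot>\<^sub>m 1\<^sub>m (fst \<pi>)" by (rule schur_scalar[OF \<pi> T])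
  then have "mat_trace T = c * of_nat (fst \<pi>)"
    by (simp add: mat_trace_smult[of _ "fst \<pi>"] mat_trace_one)
  with c irreducible_repD(2)[OF \<pi>] show ?thesis by simp
qed

lemma transfer_self:
  assumes \<pi>: "irreducible_rep G \<pi>" and M: "M \<in> carrier_mat (fst \<pi>) (fst \<pi>)"
  shows "transfer \<pi> \<pi> M = (of_nat (card (carrier G)) * mat_trace M / of_nat (fst \<pi>)) \<cdot>\<^sub>m 1\<^sub>m (fst \<pi>)"
proof -
  define n where "n = fst \<pi>"
  note rep = irreducible_repD(1)[OF \<pi>]
  have c: "\<And>g. g \<in> carrier G \<Longrightarrow> snd \<pi> g \<in> carrier_mat n n" "M \<in> carrier_mat n n"
    using rep M by (simp_all add: n_def)
  have "mat_trace (transfer \<pi> \<pi> M) = (\<Sum>g\<in>carrier G. mat_trace (snd \<pi> g * M * snd \<pi> (inv g)))"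
    unfolding transfer_def n_def[symmetric]
    by (intro mat_trace_sum mult_carrier_mat[of _ n n]) (auto simp: c)
  also have "\<dots> = (\<Sum>g\<in>carrier G. mat_trace M)"
    using c rep_inv_mult[OF rep] by (intro sum.cong refl mat_trace_similar[of _ n _ n]) (auto simp: n_def[symmetric])
  also have "\<dots> = of_nat (card (carrier G)) * mat_trace M" by simp
  finally show ?thesis
    using intertwiner_scalar_by_trace[OF \<pi> transfer_intertwines[OF rep rep M]] by simp
qed

text \<open>
  Evaluated at a matrix unit, an entry of the averaged matrix is a sum over the group of products
  of two matrix coefficients; diagonal coefficients add up to characters.
\<close>

lemma sum_chi_chi_inv_eq_transfer:
  assumes \<pi>: "is_rep G \<pi>" and \<tau>: "is_rep G \<tau>"
  shows "(\<Sum>g\<in>carrier G. chi \<tau> g * chi \<pi> (inv g)) =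
    (\<Sum>a<fst \<tau>. \<Sum>b<fst \<pi>. transfer \<pi> \<tau> (mat_unit (fst \<tau>) (fst \<pi>) a b) $$ (a, b))"
proof -
  have "(\<Sum>a<fst \<tau>. \<Sum>b<fst \<pi>. transfer \<pi> \<tau> (mat_unit (fst \<tau>) (fst \<pi>) a b) $$ (a, b)) =
     (\<Sum>a<fst \<tau>. \<Sum>b<fst \<pi>. \<Sum>g\<in>carrier G. snd \<tau> g $$ (a, a) * snd \<pi> (inv g) $$ (b, b))"
    unfolding transfer_def using \<pi> \<tau>
    by (intro sum.cong refl)
      (simp add: mat_mult_unit_mult_index[where p = "fst \<tau>" and q = "fst \<pi>"] del: index_mult_mat)
  also have "\<dots> = (\<Sum>g\<in>carrier G. \<Sum>a<fst \<tau>. \<Sum>b<fst \<pi>. snd \<tau> g $$ (a, a) * snd \<pi> (inv g) $$ (b, b))"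
    by (subst sum.swap[of _ "carrier G"]) (simp add: sum.swap[of _ "carrier G"])
  also have "\<dots> = (\<Sum>g\<in>carrier G. chi \<tau> g * chi \<pi> (inv g))"
    using \<pi> \<tau> by (simp add: mat_trace_carrier[of _ "fst \<pi>"] mat_trace_carrier[of _ "fst \<tau>"] sum_product)
  finally show ?thesis by simp
qed

lemma char_orthogonal:
  assumes "irreducible_rep G \<pi>" "irreducible_rep G \<tau>" "\<not> rep_iso G \<pi> \<tau>"
  shows "(\<Sum>g\<in>carrier G. chi \<tau> g * chi \<pi> (inv g)) = 0"
proof -
  have "transfer \<pi> \<tau> (mat_unit (fst \<tau>) (fst \<pi>) a b) = 0\<^sub>m (fst \<tau>) (fst \<pi>)" for a b
    using assms by (intro schur_iso transfer_intertwines irreducible_repD(1)) auto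
  then show ?thesis using assms
    by (subst sum_chi_chi_inv_eq_transfer) (auto simp: irreducible_repD)
qed

lemma char_norm:
  assumes "irreducible_rep G \<pi>"
  shows "(\<Sum>g\<in>carrier G. chi \<pi> g * chi \<pi> (inv g)) = of_nat (card (carrier G))"
proof -
  let ?n = "fst \<pi>" and ?c = "of_nat (card (carrier G)) :: complex"
  have "transfer \<pi> \<pi> (mat_unit ?n ?n a b) $$ (a, b) = (if a = b then ?c / of_nat ?n else 0)"
    if "a < ?n" "b < ?n" for a b
    using that by (simp add: transfer_self[OF assms] mat_trace_unit)
  then have "(\<Sum>g\<in>carrier G. chi \<pi> g * chi \<pi> (inv g)) = (\<Sum>a<?n. \<Sum>b<?n. if a = b then ?c / of_nat ?n else 0)"
    using irreducible_repD(1)[OF assms] by (simp add: sum_chi_chi_inv_eq_transfer)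
  also have "\<dots> = ?c" using irreducible_repD(2)[OF assms] by simp
  finally show ?thesis .
qed

text \<open>
  The operator \<open>\<Sum>\<^sub>g \<pi>(g k g\<inverse>)\<close> is the average of \<open>\<pi>(k)\<close>, hence a scalar that is determined by
  its trace.
\<close>

lemma sum_chi_conj_mult:
  assumes \<pi>: "irreducible_rep G \<pi>" and h: "h \<in> carrier G" and k: "k \<in> carrier G"
  shows "(\<Sum>g\<in>carrier G. chi \<pi> (h \<otimes> g \<otimes> k \<otimes> inv g)) =
    of_nat (card (carrier G)) / of_nat (fst \<pi>) * chi \<pi> h * chi \<pi> k"
proof -
  define n where "n = fst \<pi>"
  note rep = irreducible_repD(1)[OF \<pi>]
  have c: "\<And>g. g \<in> carrier G \<Longrightarrow> snd \<pi> g \<in> carrier_mat n n"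
    using rep by (simp_all add: n_def)
  have "(\<Sum>g\<in>carrier G. chi \<pi> (h \<otimes> g \<otimes> k \<otimes> inv g)) =
     (\<Sum>g\<in>carrier G. mat_trace (snd \<pi> h * (snd \<pi> g * snd \<pi> k * snd \<pi> (inv g))))"
    using h k rep_carrier[OF rep]
    by (intro sum.cong refl) (simp add: m_assoc rep_mult[OF rep] assoc_mult_mat[of _ n n _ n _ n] c)
  also have "\<dots> = mat_trace (snd \<pi> h * transfer \<pi> \<pi> (snd \<pi> k))"
    unfolding transfer_def n_def[symmetric] using h k c
    by (subst mult_mat_sum[of _ n n]) (auto intro!: mat_trace_sum[symmetric] mult_carrier_mat[of _ n n])
  also have "\<dots> = of_nat (card (carrier G)) / of_nat n * chi \<pi> h * chi \<pi> k"
    using h k c transfer_self[OF \<pi>, of "snd \<pi> k"]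
    by (simp add: n_def[symmetric] mat_trace_mult_scalar)
  finally show ?thesis by (simp add: n_def)
qed

text \<open>
  The map \<open>x \<mapsto> y x \<theta>(y)\<inverse>\<close> permutes the group and conjugates \<open>x \<theta>(x)\<close> by \<open>y\<close>, because \<open>\<theta>\<close> is an
  involution. Hence \<open>\<Sum>\<^sub>x \<pi>(x \<theta>(x))\<close> commutes with the representation and is a scalar.
\<close>

lemma sum_chi_twisted_square:
  assumes \<pi>: "irreducible_rep G \<pi>" and \<theta>: "\<theta> \<in> hom G G"
    "\<And>g. g \<in> carrier G \<Longrightarrow> \<theta> (\<theta> g) = g" and h: "h \<in> carrier G"
  shows "(\<Sum>x\<in>carrier G. chi \<pi> (h \<otimes> x \<otimes> \<theta> x)) =
    (\<Sum>x\<in>carrier G. chi \<pi> (x \<otimes> \<theta> x)) / of_nat (fst \<pi>) * chi \<pi> h"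
proof -
  define n where "n = fst \<pi>"
  interpret hom: group_hom G G \<theta>
    using \<theta>(1) by (simp add: group_hom_def group_hom_axioms_def is_group)
  note rep = irreducible_repD(1)[OF \<pi>]
  have c: "\<And>g. g \<in> carrier G \<Longrightarrow> snd \<pi> g \<in> carrier_mat n n"
    using rep by (simp_all add: n_def)
  define S where "S = mat_sum n n (\<lambda>x. snd \<pi> (x \<otimes> \<theta> x)) (carrier G)"
  have S: "S \<in> carrier_mat n n" by (simp add: S_def)
  have "S * snd \<pi> y = snd \<pi> y * S" if y: "y \<in> carrier G" for y
  proof -
    have bij: "bij_betw (\<lambda>x. y \<otimes> x \<otimes> inv (\<theta> y)) (carrier G) (carrier G)"
      using bij_betw_trans[OF bij_mult_left[OF y] bij_mult_right[of "inv (\<theta> y)"]] y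
      by (simp add: o_def)
    have "S * snd \<pi> y = mat_sum n n (\<lambda>x. snd \<pi> (x \<otimes> \<theta> x) * snd \<pi> y) (carrier G)"
      unfolding S_def using y c by (intro mat_sum_mult) auto
    also have "\<dots> = mat_sum n n (\<lambda>x. snd \<pi> (x \<otimes> \<theta> x \<otimes> y)) (carrier G)"
      using y by (intro mat_sum_cong) (simp add: rep_mult[OF rep])
    also have "\<dots> = mat_sum n n (\<lambda>x. snd \<pi> (y \<otimes> x \<otimes> inv (\<theta> y) \<otimes> \<theta> (y \<otimes> x \<otimes> inv (\<theta> y)) \<otimes> y)) (carrier G)"
      by (rule mat_sum_reindex[OF bij, symmetric])
    also have "\<dots> = mat_sum n n (\<lambda>x. snd \<pi> y * snd \<pi> (x \<otimes> \<theta> x)) (carrier G)"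
    proof (rule mat_sum_cong)
      fix x assume x: "x \<in> carrier G"
      have "y \<otimes> x \<otimes> inv (\<theta> y) \<otimes> \<theta> (y \<otimes> x \<otimes> inv (\<theta> y)) \<otimes> y =
          y \<otimes> (x \<otimes> ((inv (\<theta> y) \<otimes> \<theta> y) \<otimes> (\<theta> x \<otimes> (inv y \<otimes> y))))"
        using x y \<theta>(2) by (simp only: hom.hom_mult hom.hom_inv m_closed inv_closed hom.hom_closed m_assoc)
      also have "\<dots> = y \<otimes> (x \<otimes> \<theta> x)" using x y by (simp add: m_assoc)
      finally show "snd \<pi> (y \<otimes> x \<otimes> inv (\<theta> y) \<otimes> \<theta> (y \<otimes> x \<otimes> inv (\<theta> y)) \<otimes> y) = snd \<pi> y * snd \<pi> (x \<otimes> \<theta> x)"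
        using x y by (simp add: rep_mult[OF rep])
    qed
    also have "\<dots> = snd \<pi> y * S"
      unfolding S_def using y c by (intro mult_mat_sum[symmetric]) auto
    finally show ?thesis .
  qed
  then have int: "intertwines \<pi> \<pi> S" using S by (simp add: intertwines_def n_def)
  have trS: "mat_trace S = (\<Sum>x\<in>carrier G. chi \<pi> (x \<otimes> \<theta> x))"
    unfolding S_def using c by (intro mat_trace_sum) auto
  have "(\<Sum>x\<in>carrier G. chi \<pi> (h \<otimes> x \<otimes> \<theta> x)) = (\<Sum>x\<in>carrier G. mat_trace (snd \<pi> h * snd \<pi> (x \<otimes> \<theta> x)))"
    using h by (intro sum.cong refl) (simp add: m_assoc flip: rep_mult[OF rep])
  also have "\<dots> = mat_trace (snd \<pi> h * S)"
    unfolding S_def using h c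
    by (subst mult_mat_sum[of _ n n]) (auto intro!: mat_trace_sum[symmetric] mult_carrier_mat[of _ n n])
  also have "\<dots> = mat_trace S / of_nat n * chi \<pi> h"
    using h c by (subst intertwiner_scalar_by_trace[OF \<pi> int])
      (simp add: n_def[symmetric] mat_trace_mult_scalar)
  finally show ?thesis using trS by (simp add: n_def)
qed

section \<open>Invariant vectors and the trace\<close>

lemma subgroup_finite: "subgroup K G \<Longrightarrow> finite K"
  using finite_carrier finite_subset subgroup.subset by blast

text \<open>
  The sum of the operators \<open>\<pi>(k)\<close> over \<open>K\<close> maps every vector to an invariant one and multiplies
  invariant vectors by \<open>|K|\<close>.
\<close>

lemma sum_chi_subgroup:
  assumes rep: "is_rep G \<pi>" and K: "subgroup K G"
  shows "(\<Sum>k\<in>K. chi \<pi> k) = of_nat (card K) * of_nat (dim_invariants \<pi> K)"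
proof -
  define n where "n = fst \<pi>"
  have KG: "\<And>k. k \<in> K \<Longrightarrow> k \<in> carrier G" using subgroup.subset[OF K] by blast
  have c: "\<And>g. g \<in> K \<Longrightarrow> snd \<pi> g \<in> carrier_mat n n"
    using rep KG by (simp add: n_def)
  have W: "subspace class_ring (invariants \<pi> K) (module_vec TYPE(complex) n)"
    using c unfolding invariants_def n_def[symmetric]
    by (intro subspace_vecI)
      (auto simp: mult_add_distrib_mat_vec[of _ n n] mult_mat_vec[of _ n n] mult_mat_zero_vec[of _ n n])
  define S where "S = mat_sum n n (snd \<pi>) K"
  have S: "S \<in> carrier_mat n n" by (simp add: S_def)
  have "mat_trace S = of_nat (card K) *
    of_nat (vectorspace.dim class_ring ((module_vec TYPE(complex) n)\<lparr>carrier := invariants \<pi> K\<rparr>))"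
  proof (rule trace_of_scaled_projection[OF W S])
    fix v :: "complex vec" assume v: "v \<in> carrier_vec n"
    have "snd \<pi> y *\<^sub>v (S *\<^sub>v v) = S *\<^sub>v v" if y: "y \<in> K" for y
    proof -
      have bij: "bij_betw (\<lambda>k. y \<otimes> k) K K"
        using y KG subgroup.m_closed[OF K] subgroup.m_inv_closed[OF K]
        by (intro bij_betwI[of _ _ _ "\<lambda>k. inv y \<otimes> k"]) (auto simp flip: m_assoc)
      have "snd \<pi> y * S = mat_sum n n (\<lambda>k. snd \<pi> y * snd \<pi> k) K"
        unfolding S_def using c y by (intro mult_mat_sum) auto
      also have "\<dots> = mat_sum n n (\<lambda>k. snd \<pi> (y \<otimes> k)) K"
        using y KG by (intro mat_sum_cong) (simp add: rep_mult[OF rep])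
      also have "\<dots> = S" unfolding S_def by (rule mat_sum_reindex[OF bij])
      finally show ?thesis using assoc_mult_mat_vec[OF c[OF y] S v] by simp
    qed
    then show "S *\<^sub>v v \<in> invariants \<pi> K"
      using mult_mat_vec_carrier[OF S v] by (simp add: invariants_def n_def[symmetric])
  next
    fix w assume "w \<in> invariants \<pi> K"
    then have w: "w \<in> carrier_vec n" "\<And>k. k \<in> K \<Longrightarrow> snd \<pi> k *\<^sub>v w = w"
      by (auto simp: invariants_def n_def)
    show "S *\<^sub>v w = of_nat (card K) \<cdot>\<^sub>v w"
    proof (rule eq_vecI)
      fix i assume "i < dim_vec (of_nat (card K) \<cdot>\<^sub>v w)"
      then have i: "i < n" using w by simp
      then show "(S *\<^sub>v w) $ i = (of_nat (card K) \<cdot>\<^sub>v w) $ i"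
        unfolding S_def using w c by (subst mat_sum_mult_vec_index[of _ n]) auto
    qed (use S w in auto)
  qed
  moreover have "mat_trace S = (\<Sum>k\<in>K. chi \<pi> k)"
    unfolding S_def using c by (rule mat_trace_sum)
  ultimately show ?thesis by (simp add: dim_invariants_def n_def)
qed

section \<open>Decomposition of characters and the regular representation\<close>

text \<open>
  In coordinates adapted to a proper non-zero invariant subspace the matrices are block upper
  triangular. The two diagonal blocks are representations (on the subspace and on the quotient),
  and the trace is the sum of their traces.
\<close>

lemma reducible_character_splits:
  assumes rep: "is_rep G \<pi>" and "\<not> irreducible_rep G \<pi>" "fst \<pi> \<noteq> 0"
  obtains \<pi>\<^sub>1 \<pi>\<^sub>2 where "is_rep G \<pi>\<^sub>1" "is_rep G \<pi>\<^sub>2" "fst \<pi>\<^sub>1 < fst \<pi>" "fst \<pi>\<^sub>2 < fst \<pi>"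
    "\<And>g. g \<in> carrier G \<Longrightarrow> chi \<pi> g = chi \<pi>\<^sub>1 g + chi \<pi>\<^sub>2 g"
proof -
  define n where "n = fst \<pi>"
  have c: "\<And>g. g \<in> carrier G \<Longrightarrow> snd \<pi> g \<in> carrier_mat n n"
    using rep by (simp add: n_def)
  obtain W where W: "subspace class_ring W (module_vec TYPE(complex) n)"
    and inv: "\<And>g w. g \<in> carrier G \<Longrightarrow> w \<in> W \<Longrightarrow> snd \<pi> g *\<^sub>v w \<in> W"
    and W0: "W \<noteq> {0\<^sub>v n}" and W1: "W \<noteq> carrier_vec n"
  proof -
    have "\<not> (\<forall>W. subspace class_ring W (module_vec TYPE(complex) n) \<longrightarrow>
        (\<forall>g\<in>carrier G. \<forall>w\<in>W. snd \<pi> g *\<^sub>v w \<in> W) \<longrightarrow> W = {0\<^sub>v n} \<or> W = carrier_vec n)"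
      using assms unfolding irreducible_rep_def n_def by (simp only: simp_thms)
    then show thesis using that by blast
  qed
  have WV: "W \<subseteq> carrier_vec n" "0\<^sub>v n \<in> W"
  proof -
    have sub: "submodule class_ring W (module_vec TYPE(complex) n)" using W by (simp only: subspace_def)
    show "W \<subseteq> carrier_vec n" using submodule.subset[OF sub] by (simp add: module_vec_simps)
    show "0\<^sub>v n \<in> W" using submodule.zero_closed[OF sub] by (simp add: module_vec_simps)
  qed
  define k where "k = vectorspace.dim class_ring ((module_vec TYPE(complex) n)\<lparr>carrier := W\<rparr>)"
  obtain P Q where P: "P \<in> carrier_mat n n" and Q: "Q \<in> carrier_mat n n"
    and PQ: "P * Q = 1\<^sub>m n" "Q * P = 1\<^sub>m n" and kn: "k \<le> n"
    and mem: "\<And>v. v \<in> carrier_vec n \<Longrightarrow> v \<in> W \<longleftrightarrow> (\<forall>i. k \<le> i \<longrightarrow> i < n \<longrightarrow> (Q *\<^sub>v v) $ i = 0)"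
    using adapted_basis[OF W, folded k_def] by blast
  have "k \<noteq> 0"
  proof
    assume "k = 0"
    have "v = 0\<^sub>v n" if "v \<in> W" for v
    proof -
      have v: "v \<in> carrier_vec n" using that WV by blast
      have "Q *\<^sub>v v = 0\<^sub>v n" using mem[OF v] that \<open>k = 0\<close> Q by (intro eq_vecI) auto
      then have "P *\<^sub>v (Q *\<^sub>v v) = 0\<^sub>v n" using mult_mat_zero_vec[OF P] by simp
      then show ?thesis using assoc_mult_mat_vec[OF P Q v] PQ(1) v by simp
    qed
    then show False using W0 WV(2) by blast
  qed
  moreover have "k \<noteq> n"
  proof
    assume "k = n"
    then have "carrier_vec n \<subseteq> W" using mem by auto
    then show False using WV W1 by blast
  qed
  moreover obtain d where "n = k + d" using kn le_Suc_ex by blast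
  ultimately have d: "n = k + d" "0 < k" "0 < d" by auto
  define R where "R g = Q * snd \<pi> g * P" for g
  have R: "R g \<in> carrier_mat n n" if "g \<in> carrier G" for g
    using P Q c[OF that] by (simp add: R_def)
  have R_mult: "R (g \<otimes> h) = R g * R h" if g: "g \<in> carrier G" and h: "h \<in> carrier G" for g h
  proof -
    let ?a = "snd \<pi> g" and ?b = "snd \<pi> h"
    have 1: "Q * ?a \<in> carrier_mat n n" "?b * P \<in> carrier_mat n n" 
      by (rule mult_carrier_mat[OF Q c[OF g]], rule mult_carrier_mat[OF c[OF h] P])
    have "R g * R h = Q * ?a * (P * (Q * (?b * P)))"
      unfolding R_def using P Q c[OF g] c[OF h]
      by (simp add: assoc_mult_mat[of _ n n _ n _ n])
    also have "P * (Q * (?b * P)) = ?b * P"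
      using assoc_mult_mat[OF P Q 1(2)] PQ(1) 1(2) left_mult_one_mat[OF 1(2)] by simp
    also have "Q * ?a * (?b * P) = R (g \<otimes> h)"
      unfolding R_def rep_mult[OF rep g h] using P Q c[OF g] c[OF h]
      by (simp add: assoc_mult_mat[of _ n n _ n _ n])
    finally show ?thesis by simp
  qed
  have R_one: "R \<one> = 1\<^sub>m n" using P Q PQ by (simp add: R_def rep_one[OF rep] n_def[symmetric])
  \<comment> \<open>Splitting the summation index at \<open>k\<close> is block multiplication.\<close>
  have R_mult_index: "R (g \<otimes> h) $$ (i, j) = (\<Sum>l<k. R g $$ (i, l) * R h $$ (l, j))
      + (\<Sum>l<d. R g $$ (i, k + l) * R h $$ (k + l, j))"
    if "g \<in> carrier G" "h \<in> carrier G" "i < n" "j < n" for g h i j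
    unfolding R_mult[OF that(1,2)] using mat_mult_index[OF R[OF that(1)] R[OF that(2)] that(3,4)]
    by (simp add: d(1) sum_lessThan_add)
  \<comment> \<open>The lower left block vanishes, as the first \<open>k\<close> basis vectors span an invariant subspace.\<close>
  have block0: "R g $$ (i, j) = 0" if g: "g \<in> carrier G" and i: "k \<le> i" "i < n" and j: "j < k" for g i j
  proof -
    let ?v = "P *\<^sub>v unit_vec n j"
    have v: "?v \<in> carrier_vec n" by (rule mult_mat_vec_carrier[OF P]) simp
    have Qv: "Q *\<^sub>v ?v = unit_vec n j"
      using assoc_mult_mat_vec[OF Q P, of "unit_vec n j"] PQ(2) by simp
    have "?v \<in> W" unfolding mem[OF v] Qv using j by auto
    then have "snd \<pi> g *\<^sub>v ?v \<in> W" using inv g by blast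
    then show ?thesis using mem[OF mult_mat_vec_carrier[OF c[OF g] v]] i j kn
      by (simp add: R_def mat_mult3_index[OF Q c[OF g] P] del: index_mult_mat)
  qed
  define A where "A g = mat k k (\<lambda>(i, j). R g $$ (i, j))" for g
  define D where "D g = mat d d (\<lambda>(i, j). R g $$ (k + i, k + j))" for g
  have A: "is_rep G (k, A)"
  proof (rule repI)
    fix g h assume gh: "g \<in> carrier G" "h \<in> carrier G"
    show "A (g \<otimes> h) = A g * A h"
    proof (rule eq_matI)
      fix i j assume "i < dim_row (A g * A h)" "j < dim_col (A g * A h)"
      then have ij: "i < k" "j < k" by (auto simp: A_def)
      then have "A (g \<otimes> h) $$ (i, j) = (\<Sum>l<k. R g $$ (i, l) * R h $$ (l, j))"
        using R_mult_index[OF gh, of i j] block0[OF gh(2), of _ j] d by (simp add: A_def)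
      also have "\<dots> = (A g * A h) $$ (i, j)"
        using ij by (subst mat_mult_index[of _ k k _ k]) (auto simp: A_def)
      finally show "A (g \<otimes> h) $$ (i, j) = (A g * A h) $$ (i, j)" .
    qed (auto simp: A_def)
  next
    show "A \<one> = 1\<^sub>m k" using R_one d by (intro eq_matI) (auto simp: A_def)
  qed (auto simp: A_def)
  have D: "is_rep G (d, D)"
  proof (rule repI)
    fix g h assume gh: "g \<in> carrier G" "h \<in> carrier G"
    show "D (g \<otimes> h) = D g * D h"
    proof (rule eq_matI)
      fix i j assume "i < dim_row (D g * D h)" "j < dim_col (D g * D h)"
      then have ij: "i < d" "j < d" by (auto simp: D_def)
      then have "D (g \<otimes> h) $$ (i, j) = (\<Sum>l<d. R g $$ (k + i, k + l) * R h $$ (k + l, k + j))"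
        using R_mult_index[OF gh, of "k + i" "k + j"] block0[OF gh(1), of "k + i"] d by (simp add: D_def)
      also have "\<dots> = (D g * D h) $$ (i, j)"
        using ij by (subst mat_mult_index[of _ d d _ d]) (auto simp: D_def)
      finally show "D (g \<otimes> h) $$ (i, j) = (D g * D h) $$ (i, j)" .
    qed (auto simp: D_def)
  next
    show "D \<one> = 1\<^sub>m d" using R_one d by (intro eq_matI) (auto simp: D_def)
  qed (auto simp: D_def)
  have "chi \<pi> g = chi (k, A) g + chi (d, D) g" if g: "g \<in> carrier G" for g
  proof -
    have "chi \<pi> g = mat_trace (R g)"
      unfolding R_def by (rule mat_trace_similar[OF c[OF g] P Q PQ(1), symmetric])
    also have "\<dots> = chi (k, A) g + chi (d, D) g"
      unfolding mat_trace_carrier[OF R[OF g]] d(1) sum_lessThan_add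
      by (simp add: mat_trace_def A_def D_def)
    finally show ?thesis .
  qed
  then show thesis using that[OF A D] d by (simp add: n_def)
qed

lemma rep_isoE:
  assumes "rep_iso G \<pi> \<tau>"
  obtains T S where "fst \<tau> = fst \<pi>" "T \<in> carrier_mat (fst \<pi>) (fst \<pi>)" "S \<in> carrier_mat (fst \<pi>) (fst \<pi>)"
    "T * S = 1\<^sub>m (fst \<pi>)" "S * T = 1\<^sub>m (fst \<pi>)" "\<And>g. g \<in> carrier G \<Longrightarrow> T * snd \<pi> g = snd \<tau> g * T"
proof -
  obtain T where T: "T \<in> carrier_mat (fst \<tau>) (fst \<pi>)" "invertible_mat T"
    "\<And>g. g \<in> carrier G \<Longrightarrow> T * snd \<pi> g = snd \<tau> g * T"
    using assms unfolding rep_iso_def by blast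
  obtain S where S: "fst \<tau> = fst \<pi>" "S \<in> carrier_mat (fst \<pi>) (fst \<pi>)"
    "T * S = 1\<^sub>m (fst \<pi>)" "S * T = 1\<^sub>m (fst \<pi>)"
    using invertible_matE[OF T(2,1)] by blast
  show thesis using that[OF S(1) _ S(2-4) T(3)] T(1) S(1) by simp
qed

lemma rep_isoI:
  assumes "fst \<tau> = fst \<pi>" "T \<in> carrier_mat (fst \<pi>) (fst \<pi>)" "S \<in> carrier_mat (fst \<pi>) (fst \<pi>)"
    "T * S = 1\<^sub>m (fst \<pi>)" "S * T = 1\<^sub>m (fst \<pi>)" "\<And>g. g \<in> carrier G \<Longrightarrow> T * snd \<pi> g = snd \<tau> g * T"
  shows "rep_iso G \<pi> \<tau>"
  unfolding rep_iso_def using assms invertible_matI[OF assms(2-5)] by auto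

lemma rep_iso_chi:
  assumes rep: "is_rep G \<pi>" "is_rep G \<tau>" and "rep_iso G \<pi> \<tau>" and g: "g \<in> carrier G"
  shows "chi \<tau> g = chi \<pi> g"
proof -
  let ?n = "fst \<pi>"
  obtain T S where TS: "fst \<tau> = ?n" "T \<in> carrier_mat ?n ?n" "S \<in> carrier_mat ?n ?n"
    "T * S = 1\<^sub>m ?n" "S * T = 1\<^sub>m ?n" "T * snd \<pi> g = snd \<tau> g * T"
    using rep_isoE[OF assms(3)] g by metis
  have c: "snd \<pi> g \<in> carrier_mat ?n ?n" "snd \<tau> g \<in> carrier_mat ?n ?n"
    using rep_carrier[OF rep(1) g] rep_carrier[OF rep(2) g] TS(1) by simp_all
  have "snd \<tau> g = snd \<tau> g * T * S"
    using assoc_mult_mat[OF c(2) TS(2,3)] TS(4) c(2) by simp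
  then have "snd \<tau> g = T * snd \<pi> g * S" using TS(6) by simp
  then show ?thesis using mat_trace_similar[OF c(1) TS(3,2,5)] by simp
qed

lemma rep_iso_sym:
  assumes rep: "is_rep G \<pi>" "is_rep G \<tau>" and "rep_iso G \<pi> \<tau>"
  shows "rep_iso G \<tau> \<pi>"
proof -
  let ?n = "fst \<pi>"
  obtain T S where TS: "fst \<tau> = ?n" "T \<in> carrier_mat ?n ?n" "S \<in> carrier_mat ?n ?n"
    "T * S = 1\<^sub>m ?n" "S * T = 1\<^sub>m ?n" and int: "\<And>g. g \<in> carrier G \<Longrightarrow> T * snd \<pi> g = snd \<tau> g * T"
    using rep_isoE[OF assms(3)] by metis
  have "S * snd \<tau> g = snd \<pi> g * S" if g: "g \<in> carrier G" for g
  proof -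
    have c: "snd \<pi> g \<in> carrier_mat ?n ?n" "snd \<tau> g \<in> carrier_mat ?n ?n"
      using rep_carrier[OF rep(1) g] rep_carrier[OF rep(2) g] TS(1) by simp_all
    have "S * snd \<tau> g = S * (snd \<tau> g * (T * S))" using c TS by simp
    also have "\<dots> = S * (T * snd \<pi> g * S)"
      using assoc_mult_mat[OF c(2) TS(2,3)] int[OF g] by simp
    also have "\<dots> = S * T * (snd \<pi> g * S)"
      using c TS(2,3) by (simp add: assoc_mult_mat[of _ ?n ?n _ ?n _ ?n])
    finally show ?thesis using TS c by simp
  qed
  then show ?thesis using TS by (intro rep_isoI[of _ _ S T]) auto
qed

lemma rep_iso_trans:
  assumes rep: "is_rep G \<pi>" "is_rep G \<tau>" "is_rep G \<rho>" and iso: "rep_iso G \<pi> \<tau>" "rep_iso G \<tau> \<rho>"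
  shows "rep_iso G \<pi> \<rho>"
proof -
  let ?n = "fst \<pi>"
  obtain T S where TS: "fst \<tau> = ?n" "T \<in> carrier_mat ?n ?n" "S \<in> carrier_mat ?n ?n"
    "T * S = 1\<^sub>m ?n" "S * T = 1\<^sub>m ?n" and int: "\<And>g. g \<in> carrier G \<Longrightarrow> T * snd \<pi> g = snd \<tau> g * T"
    using rep_isoE[OF iso(1)] by metis
  obtain T' S' where TS': "fst \<rho> = ?n" "T' \<in> carrier_mat ?n ?n" "S' \<in> carrier_mat ?n ?n"
    "T' * S' = 1\<^sub>m ?n" "S' * T' = 1\<^sub>m ?n" and int': "\<And>g. g \<in> carrier G \<Longrightarrow> T' * snd \<tau> g = snd \<rho> g * T'"
    using rep_isoE[OF iso(2), unfolded TS(1)] by metis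
  have cancel: "A * B * (C * D) = 1\<^sub>m ?n"
    if "A \<in> carrier_mat ?n ?n" "B \<in> carrier_mat ?n ?n" "C \<in> carrier_mat ?n ?n" "D \<in> carrier_mat ?n ?n"
      "B * C = 1\<^sub>m ?n" "A * D = 1\<^sub>m ?n" for A B C D :: "complex mat"
  proof -
    have "A * B * (C * D) = A * (B * C * D)"
      using that(1-4) by (simp add: assoc_mult_mat[of _ ?n ?n _ ?n _ ?n])
    then show ?thesis using that by simp
  qed
  have "T' * T * snd \<pi> g = snd \<rho> g * (T' * T)" if g: "g \<in> carrier G" for g
  proof -
    have c: "snd \<pi> g \<in> carrier_mat ?n ?n" "snd \<tau> g \<in> carrier_mat ?n ?n" "snd \<rho> g \<in> carrier_mat ?n ?n"
      using rep_carrier[OF rep(1) g] rep_carrier[OF rep(2) g] rep_carrier[OF rep(3) g] TS(1) TS'(1) by simp_all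
    have "T' * T * snd \<pi> g = T' * (snd \<tau> g * T)"
      using assoc_mult_mat[OF TS'(2) TS(2) c(1)] int[OF g] by simp
    also have "\<dots> = snd \<rho> g * T' * T"
      using assoc_mult_mat[OF TS'(2) c(2) TS(2)] int'[OF g] by simp
    finally show ?thesis using assoc_mult_mat[OF c(3) TS'(2) TS(2)] by simp
  qed
  moreover have "T' * T * (S * S') = 1\<^sub>m ?n" by (rule cancel) (fact TS TS')+
  moreover have "S * S' * (T' * T) = 1\<^sub>m ?n" by (rule cancel) (fact TS TS')+
  ultimately show ?thesis
    using TS'(1) mult_carrier_mat[OF TS'(2) TS(2)] mult_carrier_mat[OF TS(3) TS'(3)]
    by (intro rep_isoI[of _ _ "T' * T" "S * S'"]) simp_all
qed

lemma rep_iso_refl: "is_rep G \<pi> \<Longrightarrow> rep_iso G \<pi> \<pi>"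
  by (intro rep_isoI[of _ _ "1\<^sub>m (fst \<pi>)" "1\<^sub>m (fst \<pi>)"]) auto

abbreviation irr_rel :: "('a rep \<times> 'a rep) set" where
  "irr_rel \<equiv> {(\<pi>, \<tau>). irreducible_rep G \<pi> \<and> irreducible_rep G \<tau> \<and> rep_iso G \<pi> \<tau>}"

lemma equiv_irr_rel: "equiv {\<pi>. irreducible_rep G \<pi>} irr_rel"
proof (rule equivI)
  show "sym irr_rel" by (auto simp: sym_def intro: rep_iso_sym irreducible_repD(1))
  show "trans irr_rel"
  proof (rule transI, clarsimp)
    fix m \<rho> n \<sigma> l \<tau>
    assume "irreducible_rep G (m, \<rho>)" "irreducible_rep G (n, \<sigma>)" "irreducible_rep G (l, \<tau>)"
      and iso: "rep_iso G (m, \<rho>) (n, \<sigma>)" "rep_iso G (n, \<sigma>) (l, \<tau>)"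
    then show "rep_iso G (m, \<rho>) (l, \<tau>)"
      by (intro rep_iso_trans[OF _ _ _ iso] irreducible_repD(1))
  qed
qed (auto simp: refl_on_def intro: rep_iso_refl irreducible_repD(1))

lemma representative_in: "C \<in> irr G \<Longrightarrow> representative C \<in> C"
  using in_quotient_imp_non_empty[OF equiv_irr_rel, of C]
  by (simp add: irr_def representative_def some_in_eq)

lemma representative_irreducible:
  assumes "C \<in> irr G" shows "irreducible_rep G (representative C)"
  using in_quotient_imp_subset[OF equiv_irr_rel, of C] representative_in[OF assms] assms
  by (auto simp: irr_def)

lemma representative_not_iso:
  assumes "C \<in> irr G" "C' \<in> irr G" "C \<noteq> C'"
  shows "\<not> rep_iso G (representative C) (representative C')"
proof
  assume "rep_iso G (representative C) (representative C')"
  then have "(representative C, representative C') \<in> irr_rel"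
    using assms representative_irreducible by simp
  then have "C = C'"
    using quotient_eq_iff[OF equiv_irr_rel _ _ representative_in[OF assms(1)] representative_in[OF assms(2)]]
      assms(1,2) unfolding irr_def by blast
  with assms show False by simp
qed

text \<open>
  Characters are invariant under isomorphism, so the character of any irreducible representation
  is the one of the chosen representative of its class.
\<close>

lemma irreducible_in_irr:
  assumes "irreducible_rep G \<pi>"
  obtains C where "C \<in> irr G" "\<And>g. g \<in> carrier G \<Longrightarrow> chi \<pi> g = chi (representative C) g"
proof -
  let ?C = "irr_rel `` {\<pi>}"
  have C: "?C \<in> irr G" unfolding irr_def using assms by (intro quotientI) simp
  have "(\<pi>, representative ?C) \<in> irr_rel"
    using representative_in[OF C] by (simp only: Image_singleton_iff)
  then have "rep_iso G \<pi> (representative ?C)" by blast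
  note rep_iso_chi[OF irreducible_repD(1)[OF assms]
      irreducible_repD(1)[OF representative_irreducible[OF C]] this, symmetric]
  then show thesis by (rule that[OF C])
qed

lemma character_decomposition:
  assumes "is_rep G \<pi>"
  shows "\<exists>S m. finite S \<and> S \<subseteq> irr G \<and>
    (\<forall>g\<in>carrier G. chi \<pi> g = (\<Sum>C\<in>S. of_nat (m C) * chi (representative C) g))"
  using assms
proof (induction "fst \<pi>" arbitrary: \<pi> rule: less_induct)
  case less
  consider "fst \<pi> = 0" | "irreducible_rep G \<pi>" | "fst \<pi> \<noteq> 0" "\<not> irreducible_rep G \<pi>" by blast
  then show ?case
  proof cases
    case 1
    then have "\<forall>g\<in>carrier G. chi \<pi> g = (\<Sum>C\<in>{}. of_nat 0 * chi (representative C) g)"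
      using rep_dim[OF less(2)] by (simp add: mat_trace_def)
    then show ?thesis by (intro exI[of _ "{}"]) auto
  next
    case 2
    obtain C where "C \<in> irr G" "\<And>g. g \<in> carrier G \<Longrightarrow> chi \<pi> g = chi (representative C) g"
      using irreducible_in_irr[OF 2] by blast
    then show ?thesis by (intro exI[of _ "{C}"] exI[of _ "\<lambda>_. 1"]) auto
  next
    case 3
    obtain \<pi>\<^sub>1 \<pi>\<^sub>2 where p: "is_rep G \<pi>\<^sub>1" "is_rep G \<pi>\<^sub>2" "fst \<pi>\<^sub>1 < fst \<pi>" "fst \<pi>\<^sub>2 < fst \<pi>"
      "\<And>g. g \<in> carrier G \<Longrightarrow> chi \<pi> g = chi \<pi>\<^sub>1 g + chi \<pi>\<^sub>2 g"
      using reducible_character_splits[OF less(2) 3(2,1)] by blast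
    obtain S1 m1 where 1: "finite S1" "S1 \<subseteq> irr G"
      "\<And>g. g \<in> carrier G \<Longrightarrow> chi \<pi>\<^sub>1 g = (\<Sum>C\<in>S1. of_nat (m1 C) * chi (representative C) g)"
      using less(1)[OF p(3,1)] by blast
    obtain S2 m2 where 2: "finite S2" "S2 \<subseteq> irr G"
      "\<And>g. g \<in> carrier G \<Longrightarrow> chi \<pi>\<^sub>2 g = (\<Sum>C\<in>S2. of_nat (m2 C) * chi (representative C) g)"
      using less(1)[OF p(4,2)] by blast
    define m where "m C = (if C \<in> S1 then m1 C else 0) + (if C \<in> S2 then m2 C else 0)" for C
    have "chi \<pi> g = (\<Sum>C\<in>S1 \<union> S2. of_nat (m C) * chi (representative C) g)" if g: "g \<in> carrier G" for g
    proof -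
      have "chi \<pi>\<^sub>1 g = (\<Sum>C\<in>S1 \<union> S2. of_nat (if C \<in> S1 then m1 C else 0) * chi (representative C) g)"
        unfolding 1(3)[OF g] using 1(1) 2(1) by (intro sum.mono_neutral_cong_left) auto
      moreover have "chi \<pi>\<^sub>2 g = (\<Sum>C\<in>S1 \<union> S2. of_nat (if C \<in> S2 then m2 C else 0) * chi (representative C) g)"
        unfolding 2(3)[OF g] using 1(1) 2(1) by (intro sum.mono_neutral_cong_left) auto
      ultimately show ?thesis
        unfolding p(5)[OF g] m_def by (simp only: of_nat_add distrib_right sum.distrib)
    qed
    then show ?thesis using 1 2 by (intro exI[of _ "S1 \<union> S2"] exI[of _ m]) auto
  qed
qed

text \<open>
  The group is enumerated by indices below its order, and \<open>g\<close> acts by the permutation matrix of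
  left multiplication, which has a fixed point only for \<open>g = \<one>\<close>.
\<close>

lemma regular_rep:
  obtains \<rho> where "is_rep G \<rho>"
    "\<And>g. g \<in> carrier G \<Longrightarrow> chi \<rho> g = (if g = \<one> then of_nat (card (carrier G)) else 0)"
proof -
  define N where "N = card (carrier G)"
  obtain x where x: "bij_betw x {0..<N} (carrier G)"
    using ex_bij_betw_nat_finite[OF finite_carrier] unfolding N_def by blast
  then have xG: "x i \<in> carrier G" if "i < N" for i using that by (auto simp: bij_betw_def)
  have inj: "x i = x j \<longleftrightarrow> i = j" if "i < N" "j < N" for i j
    using x that by (auto simp: bij_betw_def inj_on_def)
  define \<rho> where "\<rho> g = mat N N (\<lambda>(i, j). if x i = g \<otimes> x j then 1 else 0 :: complex)" for g
  have rep: "is_rep G (N, \<rho>)"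
  proof (rule repI)
    fix g h assume gh: "g \<in> carrier G" "h \<in> carrier G"
    show "\<rho> (g \<otimes> h) = \<rho> g * \<rho> h"
    proof (rule eq_matI)
      fix i j assume "i < dim_row (\<rho> g * \<rho> h)" "j < dim_col (\<rho> g * \<rho> h)"
      then have ij: "i < N" "j < N" by (auto simp: \<rho>_def)
      have "(\<rho> g * \<rho> h) $$ (i, j) =
          (\<Sum>l\<in>{0..<N}. (if x i = g \<otimes> x l then 1 else 0) * (if x l = h \<otimes> x j then 1 else 0))"
        using ij by (subst mat_mult_index[of _ N N _ N]) (auto simp: \<rho>_def lessThan_atLeast0)
      also have "\<dots> = (\<Sum>y\<in>carrier G. (if x i = g \<otimes> y then 1 else 0) * (if y = h \<otimes> x j then 1 else 0))"
        by (rule sum.reindex_bij_betw[OF x])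
      also have "\<dots> = (\<Sum>y\<in>carrier G. if y = h \<otimes> x j then if x i = g \<otimes> (h \<otimes> x j) then 1 else 0 else 0)"
        by (intro sum.cong) auto
      also have "\<dots> = \<rho> (g \<otimes> h) $$ (i, j)"
        using gh ij xG finite_carrier by (simp add: \<rho>_def m_assoc)
      finally show "\<rho> (g \<otimes> h) $$ (i, j) = (\<rho> g * \<rho> h) $$ (i, j)" by simp
    qed (auto simp: \<rho>_def)
  next
    show "\<rho> \<one> = 1\<^sub>m N" using xG inj by (intro eq_matI) (auto simp: \<rho>_def)
  qed (auto simp: \<rho>_def)
  have "x i = g \<otimes> x i \<longleftrightarrow> g = \<one>" if "g \<in> carrier G" "i < N" for g i
    using that xG by (metis l_one one_closed r_cancel)
  then have "chi (N, \<rho>) g = (if g = \<one> then of_nat N else 0)" if "g \<in> carrier G" for g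
    using that by (auto simp: mat_trace_def \<rho>_def)
  then show thesis using that[OF rep] by (simp add: N_def)
qed

text \<open>
  The regular character is some finite combination of irreducible characters. Pairing it with the
  character of a class \<open>C\<close> gives the degree on the one hand and the multiplicity of \<open>C\<close> on the other.
  Degrees are positive, so every class occurs in this combination; in particular there are finitely
  many classes.
\<close>

lemma regular_character:
  shows finite_irr: "finite (irr G)"
    and sum_dim_chi: "\<And>g. g \<in> carrier G \<Longrightarrow>
      (\<Sum>C\<in>irr G. of_nat (fst (representative C)) * chi (representative C) g) =
      (if g = \<one> then of_nat (card (carrier G)) else 0)"
proof -
  let ?N = "of_nat (card (carrier G)) :: complex"
  obtain \<rho> where \<rho>: "is_rep G \<rho>"
    "\<And>g. g \<in> carrier G \<Longrightarrow> chi \<rho> g = (if g = \<one> then ?N else 0)"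
    using regular_rep by blast
  obtain S m where S: "finite S" "S \<subseteq> irr G"
    and dec: "\<And>g. g \<in> carrier G \<Longrightarrow> chi \<rho> g = (\<Sum>C\<in>S. of_nat (m C) * chi (representative C) g)"
    using character_decomposition[OF \<rho>(1)] by blast
  have mult: "fst (representative C) = (if C \<in> S then m C else 0)" if C: "C \<in> irr G" for C
  proof -
    let ?\<pi> = "representative C"
    note irr = representative_irreducible
    have "?N * of_nat (fst ?\<pi>) = (\<Sum>g\<in>carrier G. if g = \<one> then ?N * chi ?\<pi> (inv g) else 0)"
      using finite_carrier by (simp add: chi_one[OF irreducible_repD(1)[OF irr[OF C]]])
    also have "\<dots> = (\<Sum>g\<in>carrier G. chi \<rho> g * chi ?\<pi> (inv g))"
      by (intro sum.cong) (auto simp: \<rho>(2))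
    also have "\<dots> = (\<Sum>C'\<in>S. of_nat (m C') * (\<Sum>g\<in>carrier G. chi (representative C') g * chi ?\<pi> (inv g)))"
      by (simp add: dec sum_distrib_left sum_distrib_right mult.assoc sum.swap[of _ "carrier G"])
    also have "\<dots> = (\<Sum>C'\<in>S. if C' = C then of_nat (m C) * ?N else 0)"
    proof (intro sum.cong refl)
      fix C' assume "C' \<in> S"
      then have C': "C' \<in> irr G" using S by blast
      show "of_nat (m C') * (\<Sum>g\<in>carrier G. chi (representative C') g * chi ?\<pi> (inv g)) =
          (if C' = C then of_nat (m C) * ?N else 0)"
        using char_norm[OF irr[OF C]] char_orthogonal[OF irr[OF C] irr[OF C']]
          representative_not_iso[OF C C'] by auto
    qed
    also have "\<dots> = ?N * of_nat (if C \<in> S then m C else 0)" using S(1) by simp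
    finally have "of_nat (fst ?\<pi>) = (of_nat (if C \<in> S then m C else 0) :: complex)"
      using order_pos by simp
    then show ?thesis by (simp only: of_nat_eq_iff)
  qed
  have "irr G \<subseteq> S"
    using mult irreducible_repD(2)[OF representative_irreducible] by (metis less_irrefl subsetI)
  with S have eq: "S = irr G" by blast
  with S show "finite (irr G)" by simp
  fix g assume g: "g \<in> carrier G"
  show "(\<Sum>C\<in>irr G. of_nat (fst (representative C)) * chi (representative C) g) =
      (if g = \<one> then ?N else 0)"
    using mult dec[OF g] \<rho>(2)[OF g] by (simp add: eq)
qed

end

section \<open>The twisted Frobenius-Schur theorem\<close>

locale finite_group_involution = finite_group +
  fixes \<theta> :: "'a \<Rightarrow> 'a"
  assumes hom: "\<theta> \<in> hom G G"
    and invol [simp]: "g \<in> carrier G \<Longrightarrow> \<theta> (\<theta> g) = g"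
begin

sublocale \<theta>: group_hom G G \<theta>
  using hom by (simp add: group_hom_def group_hom_axioms_def is_group)

abbreviation twisted_dual :: "'a rep \<Rightarrow> 'a rep" where
  "twisted_dual \<pi> \<equiv> twist_rep (dual_rep G \<pi>) \<theta>"

lemma twisted_dual_simps [simp]:
  "fst (twisted_dual \<pi>) = fst \<pi>"
  "snd (twisted_dual \<pi>) g = transpose_mat (snd \<pi> (inv (\<theta> g)))"
  by (simp_all add: twist_rep_def dual_rep_def)

lemma twisted_dual_rep:
  assumes rep: "is_rep G \<pi>"
  shows "is_rep G (twisted_dual \<pi>)"
proof -
  have "is_rep G (fst \<pi>, \<lambda>g. transpose_mat (snd \<pi> (inv (\<theta> g))))"
  proof (rule repI)
    fix g h assume g: "g \<in> carrier G" and h: "h \<in> carrier G"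
    have "snd \<pi> (inv (\<theta> (g \<otimes> h))) = snd \<pi> (inv (\<theta> h)) * snd \<pi> (inv (\<theta> g))"
      using g h by (simp add: inv_mult_group rep_mult[OF rep])
    then show "transpose_mat (snd \<pi> (inv (\<theta> (g \<otimes> h)))) =
        transpose_mat (snd \<pi> (inv (\<theta> g))) * transpose_mat (snd \<pi> (inv (\<theta> h)))"
      using g h rep_carrier[OF rep] by (simp add: transpose_mult[of _ "fst \<pi>" "fst \<pi>" _ "fst \<pi>"])
  qed (use rep_carrier[OF rep] in \<open>auto simp: rep_one[OF rep]\<close>)
  then show ?thesis by (simp add: twist_rep_def dual_rep_def)
qed

text \<open>
  The matrices of the bilinear forms \<open>B(v, w) = v\<^sup>T M w\<close> with \<open>B(\<pi>(g) v, w) = B(v, \<pi>(\<theta>(g\<inverse>)) w)\<close>.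
\<close>

definition twisted_invariant :: "'a rep \<Rightarrow> complex mat \<Rightarrow> bool" where
  "twisted_invariant \<pi> M \<longleftrightarrow> M \<in> carrier_mat (fst \<pi>) (fst \<pi>) \<and>
    (\<forall>g\<in>carrier G. transpose_mat (snd \<pi> g) * M = M * snd \<pi> (\<theta> (inv g)))"

text \<open>
  The two families of equations are the same after the substitution \<open>g \<mapsto> \<theta>(g\<inverse>)\<close>, which is its own
  inverse.
\<close>

lemma intertwines_twisted_dual:
  "intertwines \<pi> (twisted_dual \<pi>) M \<longleftrightarrow> twisted_invariant \<pi> M"
proof -
  have "(\<forall>g\<in>carrier G. M * snd \<pi> g = transpose_mat (snd \<pi> (inv (\<theta> g))) * M) \<longleftrightarrow>
    (\<forall>g\<in>carrier G. transpose_mat (snd \<pi> g) * M = M * snd \<pi> (\<theta> (inv g)))" (is "?l \<longleftrightarrow> ?r")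
  proof
    assume l: ?l
    show ?r
    proof
      fix g assume "g \<in> carrier G"
      then show "transpose_mat (snd \<pi> g) * M = M * snd \<pi> (\<theta> (inv g))"
        using l[rule_format, of "\<theta> (inv g)"] by simp
    qed
  next
    assume r: ?r
    show ?l
    proof
      fix g assume "g \<in> carrier G"
      then show "M * snd \<pi> g = transpose_mat (snd \<pi> (inv (\<theta> g))) * M"
        using r[rule_format, of "inv (\<theta> g)"] by simp
    qed
  qed
  then show ?thesis by (simp add: intertwines_def twisted_invariant_def)
qed

text \<open>
  A bilinear form is determined by its values on unit vectors, that is, by its Gram matrix \<open>M\<close>, and
  its properties become equations between matrices.
\<close>

lemma has_twisted_form_iff:
  assumes rep: "is_rep G \<pi>"
  shows "has_twisted_form G \<theta> \<pi> s \<longleftrightarrow>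
    (\<exists>M. twisted_invariant \<pi> M \<and> M \<noteq> 0\<^sub>m (fst \<pi>) (fst \<pi>) \<and> transpose_mat M = s \<cdot>\<^sub>m M)"
proof
  define n where "n = fst \<pi>"
  have c: "snd \<pi> g \<in> carrier_mat n n" if "g \<in> carrier G" for g
    using rep_carrier[OF rep that] by (simp add: n_def)
  {
    assume "has_twisted_form G \<theta> \<pi> s"
    then obtain B where B: "bilinear_form n B"
      and nz: "\<exists>v\<in>carrier_vec n. \<exists>w\<in>carrier_vec n. B v w \<noteq> 0"
      and sym: "\<forall>v\<in>carrier_vec n. \<forall>w\<in>carrier_vec n. B w v = s * B v w"
      and inv: "\<forall>g\<in>carrier G. \<forall>v\<in>carrier_vec n. \<forall>w\<in>carrier_vec n.
           B (snd \<pi> g *\<^sub>v v) w = B v (snd \<pi> (\<theta> (inv g)) *\<^sub>v w)"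
      unfolding has_twisted_form_def n_def[symmetric] by (elim exE conjE) (rule that)
    define M where "M = mat n n (\<lambda>(i, j). B (unit_vec n i) (unit_vec n j))"
    have M: "M \<in> carrier_mat n n" by (simp add: M_def)
    note BM = bilinear_form_matrix[OF B, folded M_def]
    have "M \<noteq> 0\<^sub>m n n"
    proof
      assume "M = 0\<^sub>m n n"
      then have "B v w = 0" if "v \<in> carrier_vec n" "w \<in> carrier_vec n" for v w
        using BM[OF that] that by (simp add: zero_mat_mult_vec)
      with nz show False by blast
    qed
    moreover have "transpose_mat M = s \<cdot>\<^sub>m M"
    proof (rule eq_matI)
      fix i j assume "i < dim_row (s \<cdot>\<^sub>m M)" "j < dim_col (s \<cdot>\<^sub>m M)"
      then show "transpose_mat M $$ (i, j) = (s \<cdot>\<^sub>m M) $$ (i, j)"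
        using sym[rule_format, of "unit_vec n i" "unit_vec n j"] by (simp add: M_def)
    qed (auto simp: M_def)
    moreover have "transpose_mat (snd \<pi> g) * M = M * snd \<pi> (\<theta> (inv g))" if g: "g \<in> carrier G" for g
    proof (rule mat_eq_by_scalar_prod[of _ n])
      have g': "\<theta> (inv g) \<in> carrier G" using g by simp
      note cg = c[OF g] c[OF g']
      show "transpose_mat (snd \<pi> g) * M \<in> carrier_mat n n" "M * snd \<pi> (\<theta> (inv g)) \<in> carrier_mat n n"
        using cg M by auto
      fix v w :: "complex vec" assume v: "v \<in> carrier_vec n" and w: "w \<in> carrier_vec n"
      have Mw: "M *\<^sub>v w \<in> carrier_vec n" by (rule mult_mat_vec_carrier[OF M w])
      have "v \<bullet> (transpose_mat (snd \<pi> g) * M *\<^sub>v w) = v \<bullet> (transpose_mat (snd \<pi> g) *\<^sub>v (M *\<^sub>v w))"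
        using cg M w by (subst assoc_mult_mat_vec[of _ n n _ n]) auto
      also have "\<dots> = (snd \<pi> g *\<^sub>v v) \<bullet> (M *\<^sub>v w)"
        by (rule scalar_prod_mult_mat_left[OF cg(1) v Mw, symmetric])
      also have "\<dots> = B (snd \<pi> g *\<^sub>v v) w"
        by (rule BM[OF mult_mat_vec_carrier[OF cg(1) v] w, symmetric])
      also have "\<dots> = B v (snd \<pi> (\<theta> (inv g)) *\<^sub>v w)" by (rule inv[rule_format, OF g v w])
      also have "\<dots> = v \<bullet> (M *\<^sub>v (snd \<pi> (\<theta> (inv g)) *\<^sub>v w))"
        by (rule BM[OF v mult_mat_vec_carrier[OF cg(2) w]])
      also have "\<dots> = v \<bullet> (M * snd \<pi> (\<theta> (inv g)) *\<^sub>v w)"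
        by (subst assoc_mult_mat_vec[OF M cg(2) w]) simp
      finally show "v \<bullet> (transpose_mat (snd \<pi> g) * M *\<^sub>v w) = v \<bullet> (M * snd \<pi> (\<theta> (inv g)) *\<^sub>v w)" .
    qed
    ultimately show "\<exists>M. twisted_invariant \<pi> M \<and> M \<noteq> 0\<^sub>m (fst \<pi>) (fst \<pi>) \<and> transpose_mat M = s \<cdot>\<^sub>m M"
      using M by (auto simp: twisted_invariant_def n_def)
  next
    assume "\<exists>M. twisted_invariant \<pi> M \<and> M \<noteq> 0\<^sub>m (fst \<pi>) (fst \<pi>) \<and> transpose_mat M = s \<cdot>\<^sub>m M"
    then obtain M where M: "M \<in> carrier_mat n n" and nz: "M \<noteq> 0\<^sub>m n n" and sym: "transpose_mat M = s \<cdot>\<^sub>m M"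
      and inv: "\<And>g. g \<in> carrier G \<Longrightarrow> transpose_mat (snd \<pi> g) * M = M * snd \<pi> (\<theta> (inv g))"
      unfolding twisted_invariant_def n_def[symmetric] by (elim exE conjE) simp
    define B where "B v w = v \<bullet> (M *\<^sub>v w)" for v w
    note Mv = mult_mat_vec_carrier[OF M]
    have bil: "bilinear_form n B"
      unfolding bilinear_form_def B_def
    proof (intro conjI ballI allI)
      fix u v w :: "complex vec" assume uvw: "u \<in> carrier_vec n" "v \<in> carrier_vec n" "w \<in> carrier_vec n"
      show "(u + v) \<bullet> (M *\<^sub>v w) = u \<bullet> (M *\<^sub>v w) + v \<bullet> (M *\<^sub>v w)"
        by (rule add_scalar_prod_distrib[OF uvw(1,2) Mv[OF uvw(3)]])
      show "w \<bullet> (M *\<^sub>v (u + v)) = w \<bullet> (M *\<^sub>v u) + w \<bullet> (M *\<^sub>v v)"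
        unfolding mult_add_distrib_mat_vec[OF M uvw(1,2)]
        by (rule scalar_prod_add_distrib[OF uvw(3) Mv[OF uvw(1)] Mv[OF uvw(2)]])
    next
      fix a and v w :: "complex vec" assume vw: "v \<in> carrier_vec n" "w \<in> carrier_vec n"
      show "(a \<cdot>\<^sub>v v) \<bullet> (M *\<^sub>v w) = a * (v \<bullet> (M *\<^sub>v w))"
        by (rule smult_scalar_prod_distrib[OF vw(1) Mv[OF vw(2)]])
      show "v \<bullet> (M *\<^sub>v (a \<cdot>\<^sub>v w)) = a * (v \<bullet> (M *\<^sub>v w))"
        unfolding mult_mat_vec[OF M vw(2)] by (rule scalar_prod_smult_distrib[OF vw(1) Mv[OF vw(2)]])
    qed
    have nzB: "\<exists>v\<in>carrier_vec n. \<exists>w\<in>carrier_vec n. B v w \<noteq> 0"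
    proof (rule ccontr)
      assume "\<not> ?thesis"
      then have "M = 0\<^sub>m n n"
        using M by (intro mat_eq_by_scalar_prod[of _ n]) (auto simp: B_def zero_mat_mult_vec)
      with nz show False by simp
    qed
    have symB: "B w v = s * B v w" if vw: "v \<in> carrier_vec n" "w \<in> carrier_vec n" for v w
    proof -
      have "B w v = (M *\<^sub>v v) \<bullet> w" unfolding B_def by (rule comm_scalar_prod[OF vw(2) Mv[OF vw(1)]])
      also have "\<dots> = v \<bullet> (s \<cdot>\<^sub>m M *\<^sub>v w)"
        unfolding scalar_prod_mult_mat_left[OF M vw] sym ..
      also have "s \<cdot>\<^sub>m M *\<^sub>v w = s \<cdot>\<^sub>v (M *\<^sub>v w)"
        using M vw by (intro eq_vecI) auto
      also have "v \<bullet> (s \<cdot>\<^sub>v (M *\<^sub>v w)) = s * B v w"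
        unfolding B_def by (rule scalar_prod_smult_distrib[OF vw(1) Mv[OF vw(2)]])
      finally show ?thesis .
    qed
    have invB: "B (snd \<pi> g *\<^sub>v v) w = B v (snd \<pi> (\<theta> (inv g)) *\<^sub>v w)"
      if g: "g \<in> carrier G" and v: "v \<in> carrier_vec n" and w: "w \<in> carrier_vec n" for g v w
    proof -
      have g': "\<theta> (inv g) \<in> carrier G" using g by simp
      have "B (snd \<pi> g *\<^sub>v v) w = v \<bullet> (transpose_mat (snd \<pi> g) *\<^sub>v (M *\<^sub>v w))"
        unfolding B_def by (rule scalar_prod_mult_mat_left[OF c[OF g] v Mv[OF w]])
      also have "\<dots> = v \<bullet> (transpose_mat (snd \<pi> g) * M *\<^sub>v w)"
        using c[OF g] M w by (subst assoc_mult_mat_vec[of _ n n _ n]) auto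
      also have "\<dots> = v \<bullet> (M *\<^sub>v (snd \<pi> (\<theta> (inv g)) *\<^sub>v w))"
        unfolding inv[OF g] assoc_mult_mat_vec[OF M c[OF g'] w] ..
      finally show ?thesis by (simp add: B_def)
    qed
    show "has_twisted_form G \<theta> \<pi> s"
      unfolding has_twisted_form_def n_def[symmetric]
      by (intro exI[of _ B] conjI ballI bil nzB symB invB)
  }
qed

text \<open>
  Exchanging the two arguments of the form preserves the invariance because \<open>\<theta>\<close> is an involution:
  transpose the condition for \<open>\<theta>(g\<inverse>)\<close>.
\<close>

lemma twisted_invariant_transpose:
  assumes rep: "is_rep G \<pi>" and M: "twisted_invariant \<pi> M"
  shows "twisted_invariant \<pi> (transpose_mat M)"
  unfolding twisted_invariant_def
proof (intro conjI ballI)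
  define n where "n = fst \<pi>"
  have Mc: "M \<in> carrier_mat n n" using M by (simp add: twisted_invariant_def n_def)
  then show "transpose_mat M \<in> carrier_mat (fst \<pi>) (fst \<pi>)" by (simp add: n_def)
  fix g assume g: "g \<in> carrier G"
  then have g': "\<theta> (inv g) \<in> carrier G" by simp
  have c: "snd \<pi> g \<in> carrier_mat n n" "snd \<pi> (\<theta> (inv g)) \<in> carrier_mat n n"
    using rep_carrier[OF rep g] rep_carrier[OF rep g'] by (simp_all add: n_def)
  have "transpose_mat (snd \<pi> (\<theta> (inv g))) * M = M * snd \<pi> (\<theta> (inv (\<theta> (inv g))))"
    using M g' by (simp add: twisted_invariant_def)
  also have "\<theta> (inv (\<theta> (inv g))) = g" using g by simp
  finally have "transpose_mat (transpose_mat (snd \<pi> (\<theta> (inv g))) * M) = transpose_mat (M * snd \<pi> g)"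
    by simp
  then show "transpose_mat (snd \<pi> g) * transpose_mat M = transpose_mat M * snd \<pi> (\<theta> (inv g))"
    using transpose_mult[OF Mc c(1)] transpose_mult[OF _ Mc, of "transpose_mat (snd \<pi> (\<theta> (inv g)))" n] c by simp
qed

context
  fixes \<pi> :: "'a rep"
  assumes \<pi>: "irreducible_rep G \<pi>"
begin

lemma twisted_invariant_invertible:
  assumes M: "twisted_invariant \<pi> M" and nz: "M \<noteq> 0\<^sub>m (fst \<pi>) (fst \<pi>)"
  obtains N where "N \<in> carrier_mat (fst \<pi>) (fst \<pi>)" "M * N = 1\<^sub>m (fst \<pi>)" "N * M = 1\<^sub>m (fst \<pi>)"
  using schur_invertible[OF \<pi> twisted_dual_rep[OF irreducible_repD(1)[OF \<pi>]], of M] M nz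
  by (auto simp: intertwines_twisted_dual)

lemma twisted_invariant_rep_iso:
  assumes M: "twisted_invariant \<pi> M" and nz: "M \<noteq> 0\<^sub>m (fst \<pi>) (fst \<pi>)"
  shows "rep_iso G \<pi> (twisted_dual \<pi>)"
proof -
  obtain N where "N \<in> carrier_mat (fst \<pi>) (fst \<pi>)" "M * N = 1\<^sub>m (fst \<pi>)" "N * M = 1\<^sub>m (fst \<pi>)"
    using twisted_invariant_invertible[OF M nz] by blast
  moreover have "M \<in> carrier_mat (fst \<pi>) (fst \<pi>)" using M by (simp add: twisted_invariant_def)
  moreover have "intertwines \<pi> (twisted_dual \<pi>) M" using M by (simp add: intertwines_twisted_dual)
  ultimately show ?thesis by (intro rep_isoI[of _ _ M N]) (auto simp: intertwines_def)
qed

text \<open>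
  An invariant form identifies \<open>\<pi>\<^sup>* \<circ> \<theta>\<close> with \<open>\<pi>\<close>. Writing \<open>A = M (N A)\<close> moves \<open>M\<close> out of the average
  and leaves the average of \<open>N A\<close> over \<open>\<pi>\<close> itself.
\<close>

lemma transfer_twisted_dual:
  assumes M: "twisted_invariant \<pi> M" and N: "N \<in> carrier_mat (fst \<pi>) (fst \<pi>)" and MN: "M * N = 1\<^sub>m (fst \<pi>)"
    and A: "A \<in> carrier_mat (fst \<pi>) (fst \<pi>)"
  shows "transfer \<pi> (twisted_dual \<pi>) A =
    (of_nat (card (carrier G)) * mat_trace (N * A) / of_nat (fst \<pi>)) \<cdot>\<^sub>m M"
proof -
  define n where "n = fst \<pi>"
  note rep = irreducible_repD(1)[OF \<pi>]
  have c: "snd \<pi> g \<in> carrier_mat n n" if "g \<in> carrier G" for g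
    using rep_carrier[OF rep that] by (simp add: n_def)
  have Mc: "M \<in> carrier_mat n n" and Nc: "N \<in> carrier_mat n n" and Ac: "A \<in> carrier_mat n n"
    using M N A by (simp_all add: twisted_invariant_def n_def)
  have NA: "N * A \<in> carrier_mat n n" using Nc Ac by simp
  let ?\<tau> = "snd (twisted_dual \<pi>)"
  have "transfer \<pi> (twisted_dual \<pi>) A = mat_sum n n (\<lambda>g. M * (snd \<pi> g * (N * A) * snd \<pi> (inv g))) (carrier G)"
    unfolding transfer_def twisted_dual_simps(1) n_def[symmetric]
  proof (rule mat_sum_cong)
    fix g assume g: "g \<in> carrier G"
    have g': "inv g \<in> carrier G" using g by simp
    have \<tau>: "?\<tau> g \<in> carrier_mat n n"
      using rep_carrier[OF twisted_dual_rep[OF rep] g] by (simp add: n_def)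
    have "?\<tau> g * A = ?\<tau> g * (M * N * A)" using MN Ac by (simp add: n_def[symmetric])
    also have "\<dots> = ?\<tau> g * M * (N * A)"
      using \<tau> Mc Nc Ac NA by (simp add: assoc_mult_mat[of _ n n _ n _ n])
    also have "?\<tau> g * M = M * snd \<pi> g"
      using M g unfolding intertwines_twisted_dual[symmetric] intertwines_def by simp
    also have "M * snd \<pi> g * (N * A) = M * (snd \<pi> g * (N * A))"
      by (rule assoc_mult_mat[OF Mc c[OF g] NA])
    finally have "?\<tau> g * A * snd \<pi> (inv g) = M * (snd \<pi> g * (N * A)) * snd \<pi> (inv g)" by simp
    also have "\<dots> = M * (snd \<pi> g * (N * A) * snd \<pi> (inv g))"
      by (rule assoc_mult_mat[OF Mc mult_carrier_mat[OF c[OF g] NA] c[OF g']])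
    finally show "?\<tau> g * A * snd \<pi> (inv g) = M * (snd \<pi> g * (N * A) * snd \<pi> (inv g))" .
  qed
  also have "\<dots> = M * transfer \<pi> \<pi> (N * A)"
    unfolding transfer_def n_def[symmetric]
    by (intro mult_mat_sum[OF Mc, symmetric] mult_carrier_mat[of _ n n] c NA) auto
  also have "\<dots> = (of_nat (card (carrier G)) * mat_trace (N * A) / of_nat n) \<cdot>\<^sub>m M"
    using transfer_self[OF \<pi>, of "N * A"] NA Mc
    by (simp add: n_def[symmetric] mult_smult_distrib[OF Mc one_carrier_mat])
  finally show ?thesis by (simp add: n_def)
qed

text \<open>
  The entry of the averaged matrix unit is taken at the transposed position, which is what combines
  the matrix coefficients into the trace of a product instead of a product of traces.
\<close>

lemma sum_chi_twisted_square_eq_transfer: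
  "(\<Sum>g\<in>carrier G. chi \<pi> (g \<otimes> \<theta> g)) =
    (\<Sum>a<fst \<pi>. \<Sum>b<fst \<pi>. transfer \<pi> (twisted_dual \<pi>) (mat_unit (fst \<pi>) (fst \<pi>) a b) $$ (b, a))"
proof -
  define n where "n = fst \<pi>"
  note rep = irreducible_repD(1)[OF \<pi>]
  have c: "snd \<pi> g \<in> carrier_mat n n" if "g \<in> carrier G" for g
    using rep_carrier[OF rep that] by (simp add: n_def)
  have "(\<Sum>a<n. \<Sum>b<n. transfer \<pi> (twisted_dual \<pi>) (mat_unit n n a b) $$ (b, a)) =
     (\<Sum>a<n. \<Sum>b<n. \<Sum>g\<in>carrier G. snd \<pi> (inv (\<theta> g)) $$ (a, b) * snd \<pi> (inv g) $$ (b, a))"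
  proof (intro sum.cong refl)
    fix a b assume "a \<in> {..<n}" "b \<in> {..<n}"
    then have ab: "a < n" "b < n" by auto
    have "(transpose_mat (snd \<pi> (inv (\<theta> g))) * mat_unit n n a b * snd \<pi> (inv g)) $$ (b, a) =
        snd \<pi> (inv (\<theta> g)) $$ (a, b) * snd \<pi> (inv g) $$ (b, a)" if g: "g \<in> carrier G" for g
      using mat_mult_unit_mult_index[of "transpose_mat (snd \<pi> (inv (\<theta> g)))" n n "snd \<pi> (inv g)" n n a b b a]
        c[of "inv (\<theta> g)"] c[of "inv g"] g ab by simp
    then show "transfer \<pi> (twisted_dual \<pi>) (mat_unit n n a b) $$ (b, a) =
        (\<Sum>g\<in>carrier G. snd \<pi> (inv (\<theta> g)) $$ (a, b) * snd \<pi> (inv g) $$ (b, a))"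
      using ab by (simp add: transfer_def n_def[symmetric])
  qed
  also have "\<dots> = (\<Sum>g\<in>carrier G. \<Sum>a<n. \<Sum>b<n. snd \<pi> (inv (\<theta> g)) $$ (a, b) * snd \<pi> (inv g) $$ (b, a))"
    by (subst sum.swap[of _ "carrier G"]) (simp add: sum.swap[of _ "carrier G"])
  also have "\<dots> = (\<Sum>g\<in>carrier G. chi \<pi> (inv (\<theta> g) \<otimes> inv g))"
    using c by (intro sum.cong refl) (simp add: rep_mult[OF rep] mat_trace_mult[of _ n n])
  also have "\<dots> = (\<Sum>g\<in>carrier G. chi \<pi> (inv g \<otimes> \<theta> (inv g)))"
    by (intro sum.cong refl) (simp add: chi_mult_commute[OF rep])
  also have "\<dots> = (\<Sum>g\<in>carrier G. chi \<pi> (g \<otimes> \<theta> g))"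
    by (rule sum.reindex_bij_betw[OF bij_inv])
  finally show ?thesis by (simp add: n_def)
qed

lemma frobenius_schur_zero:
  assumes "\<And>M. twisted_invariant \<pi> M \<Longrightarrow> M = 0\<^sub>m (fst \<pi>) (fst \<pi>)"
  shows "(\<Sum>g\<in>carrier G. chi \<pi> (g \<otimes> \<theta> g)) = 0"
proof -
  note rep = irreducible_repD(1)[OF \<pi>]
  have "transfer \<pi> (twisted_dual \<pi>) (mat_unit (fst \<pi>) (fst \<pi>) a b) = 0\<^sub>m (fst \<pi>) (fst \<pi>)" for a b
    using transfer_intertwines[OF rep twisted_dual_rep[OF rep]]
    by (intro assms) (simp flip: intertwines_twisted_dual)
  then show ?thesis by (simp add: sum_chi_twisted_square_eq_transfer)
qed

text \<open>
  The sum over the entries is a multiple of the trace of \<open>N * transpose_mat M\<close>, where \<open>N\<close> is the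
  inverse of \<open>M\<close>, and this product is \<open>s\<close> times the identity.
\<close>

lemma frobenius_schur_sign:
  assumes M: "twisted_invariant \<pi> M" and nz: "M \<noteq> 0\<^sub>m (fst \<pi>) (fst \<pi>)" and sym: "transpose_mat M = s \<cdot>\<^sub>m M"
  shows "(\<Sum>g\<in>carrier G. chi \<pi> (g \<otimes> \<theta> g)) = s * of_nat (card (carrier G))"
proof -
  define n where "n = fst \<pi>"
  let ?c = "of_nat (card (carrier G)) :: complex"
  have n: "n > 0" using irreducible_repD(2)[OF \<pi>] by (simp add: n_def)
  have Mc: "M \<in> carrier_mat n n" using M by (simp add: twisted_invariant_def n_def)
  obtain N where N: "N \<in> carrier_mat n n" "M * N = 1\<^sub>m n" "N * M = 1\<^sub>m n"
    using twisted_invariant_invertible[OF M nz] by (auto simp: n_def)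
  have sym': "M $$ (b, a) = s * M $$ (a, b)" if "a < n" "b < n" for a b
    using arg_cong[OF sym, of "\<lambda>A. A $$ (a, b)"] Mc that by simp
  have "(\<Sum>g\<in>carrier G. chi \<pi> (g \<otimes> \<theta> g)) =
      (\<Sum>a<n. \<Sum>b<n. transfer \<pi> (twisted_dual \<pi>) (mat_unit n n a b) $$ (b, a))"
    by (simp add: sum_chi_twisted_square_eq_transfer n_def)
  also have "\<dots> = (\<Sum>a<n. \<Sum>b<n. ?c * s / of_nat n * (M $$ (a, b) * N $$ (b, a)))"
  proof (intro sum.cong refl)
    fix a b assume "a \<in> {..<n}" "b \<in> {..<n}"
    then have ab: "a < n" "b < n" by auto
    have "mat_trace (N * mat_unit n n a b) = N $$ (b, a)"
      using mat_trace_mult_commute[OF N(1), of "mat_unit n n a b"] mat_trace_unit_mult[OF N(1) ab] by simp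
    then show "transfer \<pi> (twisted_dual \<pi>) (mat_unit n n a b) $$ (b, a) =
        ?c * s / of_nat n * (M $$ (a, b) * N $$ (b, a))"
      using transfer_twisted_dual[OF M, of N "mat_unit n n a b"] N ab Mc sym'[OF ab]
      by (simp add: n_def[symmetric])
  qed
  also have "\<dots> = ?c * s / of_nat n * mat_trace (M * N)"
    by (simp add: mat_trace_mult[OF Mc N(1)] sum_distrib_left)
  also have "\<dots> = s * ?c" using n by (simp add: N(2) mat_trace_one)
  finally show ?thesis .
qed

text \<open>
  By Schur's lemma \<open>M\<close> and its transpose are proportional, and the factor squares to \<open>1\<close> because
  transposing twice changes nothing.
\<close>

lemma twisted_invariant_symmetry:
  assumes M: "twisted_invariant \<pi> M" and nz: "M \<noteq> 0\<^sub>m (fst \<pi>) (fst \<pi>)"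
  shows "transpose_mat M = 1 \<cdot>\<^sub>m M \<or> transpose_mat M = (-1) \<cdot>\<^sub>m M"
proof -
  define n where "n = fst \<pi>"
  let ?c = "of_nat (card (carrier G)) :: complex"
  note rep = irreducible_repD(1)[OF \<pi>]
  have n: "n > 0" using irreducible_repD(2)[OF \<pi>] by (simp add: n_def)
  have Mc: "M \<in> carrier_mat n n" using M by (simp add: twisted_invariant_def n_def)
  obtain N where N: "N \<in> carrier_mat n n" "M * N = 1\<^sub>m n" "N * M = 1\<^sub>m n"
    using twisted_invariant_invertible[OF M nz] by (auto simp: n_def)
  have Tc: "transpose_mat M \<in> carrier_mat n n" using Mc by simp
  have NT: "N * transpose_mat M \<in> carrier_mat n n" using N Tc by simp
  have int: "intertwines \<pi> (twisted_dual \<pi>) M" "intertwines \<pi> (twisted_dual \<pi>) (transpose_mat M)"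
    using M twisted_invariant_transpose[OF rep M] by (simp_all add: intertwines_twisted_dual)
  have "intertwines \<pi> \<pi> (N * transpose_mat M)"
    unfolding intertwines_def n_def[symmetric]
  proof (intro conjI ballI NT)
    fix g assume g: "g \<in> carrier G"
    let ?p = "snd \<pi> g" and ?q = "snd (twisted_dual \<pi>) g"
    have c: "?p \<in> carrier_mat n n" "?q \<in> carrier_mat n n"
      using rep_carrier[OF rep g] rep_carrier[OF twisted_dual_rep[OF rep] g] by (simp_all add: n_def)
    have i: "M * ?p = ?q * M" "transpose_mat M * ?p = ?q * transpose_mat M"
      using int g unfolding intertwines_def by blast+
    have "N * ?q = N * (?q * (M * N))" using N c by simp
    also have "\<dots> = N * (M * ?p * N)" unfolding i(1) by (simp only: assoc_mult_mat[OF c(2) Mc N(1)])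
    also have "\<dots> = N * M * (?p * N)"
      unfolding assoc_mult_mat[OF Mc c(1) N(1)]
      by (rule assoc_mult_mat[OF N(1) Mc mult_carrier_mat[OF c(1) N(1)], symmetric])
    also have "\<dots> = ?p * N" using N c by simp
    finally have Nq: "N * ?q = ?p * N" .
    have "N * transpose_mat M * ?p = N * (?q * transpose_mat M)"
      unfolding assoc_mult_mat[OF N(1) Tc c(1)] i(2) ..
    also have "\<dots> = ?p * N * transpose_mat M"
      unfolding Nq[symmetric] by (rule assoc_mult_mat[OF N(1) c(2) Tc, symmetric])
    finally show "N * transpose_mat M * ?p = ?p * (N * transpose_mat M)"
      unfolding assoc_mult_mat[OF c(1) N(1) Tc] .
  qed
  then obtain s where "N * transpose_mat M = s \<cdot>\<^sub>m 1\<^sub>m n"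
    using schur_scalar[OF \<pi>] unfolding n_def by blast
  then have "M * (N * transpose_mat M) = s \<cdot>\<^sub>m M"
    using mult_smult_distrib[OF Mc one_carrier_mat] Mc by simp
  then have s: "transpose_mat M = s \<cdot>\<^sub>m M"
    using assoc_mult_mat[OF Mc N(1) Tc] N(2) Tc left_mult_one_mat[OF Tc] by simp
  have entry: "M $$ (j, i) = s * M $$ (i, j)" if "i < n" "j < n" for i j
    using arg_cong[OF s, of "\<lambda>A. A $$ (i, j)"] Mc that by simp
  obtain i j where ij: "i < n" "j < n" "M $$ (i, j) \<noteq> 0"
    using nz Mc unfolding n_def by (metis carrier_matD eq_matI index_zero_mat)
  have "M $$ (i, j) = s * s * M $$ (i, j)"
    using entry[OF ij(1,2)] entry[OF ij(2,1)] by simp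
  then have "s * s = 1" using ij(3) by simp
  then have "s = 1 \<or> s = -1" by (simp add: square_eq_1_iff)
  then show ?thesis using s by auto
qed

text \<open>
  In each of the three cases that define the indicator, the value of the sum is forced. This yields
  the formula and also shows that the three cases exclude each other, so that the indicator is well
  defined.
\<close>

lemma twisted_frobenius_schur:
  "(\<Sum>g\<in>carrier G. chi \<pi> (g \<otimes> \<theta> g)) = of_int (twisted_FS G \<theta> \<pi>) * of_nat (card (carrier G))"
proof -
  let ?S = "\<Sum>g\<in>carrier G. chi \<pi> (g \<otimes> \<theta> g)"
  let ?c = "of_nat (card (carrier G)) :: complex"
  define P where "P e \<longleftrightarrow> (e = 0 \<and> \<not> rep_iso G \<pi> (twisted_dual \<pi>)) \<or>
     (e = 1 \<and> has_twisted_form G \<theta> \<pi> 1) \<or> (e = -1 \<and> has_twisted_form G \<theta> \<pi> (-1))" for e :: int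
  note form = has_twisted_form_iff[OF irreducible_repD(1)[OF \<pi>]]
  have val: "?S = of_int e * ?c" if "P e" for e
    using that unfolding P_def form
  proof (elim disjE conjE exE)
    assume "e = 0" "\<not> rep_iso G \<pi> (twisted_dual \<pi>)"
    then show ?thesis using frobenius_schur_zero twisted_invariant_rep_iso by auto
  qed (use frobenius_schur_sign in auto)
  \<comment> \<open>Existence of the indicator; it is unique because \<open>val\<close> determines it from the sum.\<close>
  have "\<exists>e. P e"
  proof (cases "\<exists>M. twisted_invariant \<pi> M \<and> M \<noteq> 0\<^sub>m (fst \<pi>) (fst \<pi>)")
    case True
    then have "has_twisted_form G \<theta> \<pi> 1 \<or> has_twisted_form G \<theta> \<pi> (-1)"
      unfolding form using twisted_invariant_symmetry by blast
    then show ?thesis unfolding P_def by blast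
  next
    case False
    have "\<not> rep_iso G \<pi> (twisted_dual \<pi>)"
    proof
      assume "rep_iso G \<pi> (twisted_dual \<pi>)"
      then obtain T S where T: "T \<in> carrier_mat (fst \<pi>) (fst \<pi>)" "S \<in> carrier_mat (fst \<pi>) (fst \<pi>)"
        "T * S = 1\<^sub>m (fst \<pi>)" "\<And>g. g \<in> carrier G \<Longrightarrow> T * snd \<pi> g = snd (twisted_dual \<pi>) g * T"
        by (elim rep_isoE) blast
      then have "twisted_invariant \<pi> T" by (simp add: intertwines_def flip: intertwines_twisted_dual)
      with False have "T = 0\<^sub>m (fst \<pi>) (fst \<pi>)" by blast
      then have "(1\<^sub>m (fst \<pi>) :: complex mat) = 0\<^sub>m (fst \<pi>) (fst \<pi>)" using T by simp
      from arg_cong[OF this, of "\<lambda>A. A $$ (0, 0)"] irreducible_repD(2)[OF \<pi>] show False by simp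
    qed
    then show ?thesis unfolding P_def by blast
  qed
  moreover have "e = e'" if "P e" "P e'" for e e'
    using val[OF that(1)] val[OF that(2)] order_pos by simp
  ultimately have "P (THE e. P e)" by (metis theI')
  then show ?thesis using val unfolding twisted_FS_def P_def by blast
qed

end

end

section \<open>Double cosets\<close>

context finite_group begin

context
  fixes H K :: "'a set"
  assumes H: "subgroup H G" and K: "subgroup K G"
begin

lemma in_H [simp]: "h \<in> H \<Longrightarrow> h \<in> carrier G" using subgroup.subset[OF H] by blast
lemma in_K [simp]: "k \<in> K \<Longrightarrow> k \<in> carrier G" using subgroup.subset[OF K] by blast

abbreviation dcoset :: "'a \<Rightarrow> 'a set" where
  "dcoset g \<equiv> H <#> {g} <#> K"

lemma in_dcoset: "x \<in> dcoset g \<longleftrightarrow> (\<exists>h\<in>H. \<exists>k\<in>K. x = h \<otimes> g \<otimes> k)"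
  by (auto simp: set_mult_def)

lemma dcoset_subset: "g \<in> carrier G \<Longrightarrow> dcoset g \<subseteq> carrier G"
  by (auto simp: in_dcoset)

lemma dcoset_self: "g \<in> carrier G \<Longrightarrow> g \<in> dcoset g"
  using subgroup.one_closed[OF H] subgroup.one_closed[OF K] by (force simp: in_dcoset)

lemma dcoset_mono:
  assumes g: "g \<in> carrier G" and x: "x \<in> dcoset g"
  shows "dcoset x \<subseteq> dcoset g"
proof
  fix y assume "y \<in> dcoset x"
  then obtain h k where hk: "h \<in> H" "k \<in> K" "y = h \<otimes> x \<otimes> k" by (auto simp: in_dcoset)
  obtain a b where ab: "a \<in> H" "b \<in> K" "x = a \<otimes> g \<otimes> b" using x by (auto simp: in_dcoset)
  have "y = (h \<otimes> a) \<otimes> g \<otimes> (b \<otimes> k)" using hk ab g by (simp add: m_assoc)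
  moreover have "h \<otimes> a \<in> H" "b \<otimes> k \<in> K"
    using hk ab subgroup.m_closed[OF H] subgroup.m_closed[OF K] by auto
  ultimately show "y \<in> dcoset g" unfolding in_dcoset by blast
qed

lemma dcoset_sym:
  assumes g: "g \<in> carrier G" and x: "x \<in> dcoset g"
  shows "g \<in> dcoset x"
proof -
  obtain a b where ab: "a \<in> H" "b \<in> K" "x = a \<otimes> g \<otimes> b" using x by (auto simp: in_dcoset)
  have "inv a \<otimes> x \<otimes> inv b = (inv a \<otimes> a) \<otimes> g \<otimes> (b \<otimes> inv b)"
    unfolding ab(3) using ab(1,2) g by (simp only: m_assoc m_closed inv_closed in_H in_K)
  also have "\<dots> = g" using ab(1,2) g by simp
  finally have "g = inv a \<otimes> x \<otimes> inv b" by simp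
  moreover have "inv a \<in> H" "inv b \<in> K"
    using ab subgroup.m_inv_closed[OF H] subgroup.m_inv_closed[OF K] by auto
  ultimately show ?thesis unfolding in_dcoset by blast
qed

lemma dcoset_eq:
  assumes g: "g \<in> carrier G" and x: "x \<in> dcoset g"
  shows "dcoset x = dcoset g"
proof
  have "x \<in> carrier G" using x dcoset_subset[OF g] by blast
  then show "dcoset g \<subseteq> dcoset x" using dcoset_sym[OF g x] by (intro dcoset_mono)
qed (rule dcoset_mono[OF g x])

lemma double_cosetsI: "g \<in> carrier G \<Longrightarrow> dcoset g \<in> double_cosets G H K"
  by (auto simp: double_cosets_def)

lemma double_cosetsE:
  assumes "D \<in> double_cosets G H K"
  obtains g where "g \<in> carrier G" "D = dcoset g"
  using assms by (auto simp: double_cosets_def)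

lemma double_coset_eq_dcoset:
  assumes "D \<in> double_cosets G H K" "x \<in> D"
  shows "x \<in> carrier G" "D = dcoset x"
proof -
  obtain g where g: "g \<in> carrier G" "D = dcoset g" using assms(1) by (rule double_cosetsE)
  show "x \<in> carrier G" using assms(2) dcoset_subset[OF g(1)] g(2) by blast
  show "D = dcoset x" using dcoset_eq[OF g(1)] assms(2) g(2) by simp
qed

lemma finite_double_cosets: "finite (double_cosets G H K)"
  using finite_carrier by (auto simp: double_cosets_def)

lemma Union_double_cosets: "\<Union> (double_cosets G H K) = carrier G"
proof (intro equalityI subsetI)
  fix x assume "x \<in> carrier G"
  then show "x \<in> \<Union> (double_cosets G H K)" using dcoset_self double_cosetsI by (intro UnionI)
qed (use double_coset_eq_dcoset(1) in blast)

definition links :: "'a \<Rightarrow> 'a \<Rightarrow> nat" where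
  "links x y = card {p \<in> H \<times> K. fst p \<otimes> x \<otimes> snd p = y}"

text \<open>
  Replacing \<open>x\<close> by \<open>a \<otimes> x \<otimes> b\<close> translates the solution set by \<open>(a, b)\<close>.
\<close>

lemma links_cong_left:
  assumes x: "x \<in> carrier G" and x': "x' \<in> dcoset x"
  shows "links x' y = links x y"
proof -
  obtain a b where ab: "a \<in> H" "b \<in> K" "x' = a \<otimes> x \<otimes> b" using x' by (auto simp: in_dcoset)
  have shift: "h \<otimes> x' \<otimes> k = (h \<otimes> a) \<otimes> x \<otimes> (b \<otimes> k)" if "h \<in> H" "k \<in> K" for h k
    using that ab x by (simp add: m_assoc)
  have "bij_betw (\<lambda>(h, k). (h \<otimes> a, b \<otimes> k))
      {p \<in> H \<times> K. fst p \<otimes> x' \<otimes> snd p = y} {p \<in> H \<times> K. fst p \<otimes> x \<otimes> snd p = y}"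
  proof (rule bij_betwI[of _ _ _ "\<lambda>(h, k). (h \<otimes> inv a, inv b \<otimes> k)"], goal_cases)
    case 1
    show ?case using ab shift subgroup.m_closed[OF H] subgroup.m_closed[OF K] by auto
  next
    case 2
    show ?case
    proof (clarsimp, intro conjI)
      fix h k assume hk: "h \<in> H" "k \<in> K"
      show 1: "h \<otimes> inv a \<in> H" "inv b \<otimes> k \<in> K"
        using hk ab subgroup.m_closed[OF H] subgroup.m_closed[OF K]
          subgroup.m_inv_closed[OF H] subgroup.m_inv_closed[OF K] by auto
      show "h \<otimes> inv a \<otimes> x' \<otimes> (inv b \<otimes> k) = h \<otimes> x \<otimes> k"
        unfolding shift[OF 1] using hk ab by (simp add: m_assoc inv_solve_left) (simp flip: m_assoc)
    qed
  next
    case (3 p)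
    then show ?case using ab by (auto simp: m_assoc) (simp flip: m_assoc)
  next
    case (4 p)
    then show ?case using ab by (auto simp: m_assoc) (simp flip: m_assoc)
  qed
  then show ?thesis unfolding links_def by (rule bij_betw_same_card)
qed

lemma sum_links_dcoset:
  assumes x: "x \<in> carrier G"
  shows "(\<Sum>y\<in>dcoset x. links x y) = card H * card K"
proof -
  have fin: "finite (H \<times> K)" using subgroup_finite[OF H] subgroup_finite[OF K] by simp
  have finO: "finite (dcoset x)" using finite_subset[OF dcoset_subset[OF x] finite_carrier] .
  have "(\<Sum>y\<in>dcoset x. links x y) =
      (\<Sum>y\<in>dcoset x. \<Sum>p | p \<in> H \<times> K \<and> fst p \<otimes> x \<otimes> snd p = y. 1)"
    by (simp add: links_def)
  also have "\<dots> = (\<Sum>p\<in>H \<times> K. 1)"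
  proof (rule sum.group[OF fin finO])
    show "(\<lambda>p. fst p \<otimes> x \<otimes> snd p) ` (H \<times> K) \<subseteq> dcoset x"
    proof (rule image_subsetI)
      fix p assume "p \<in> H \<times> K"
      then have "fst p \<in> H" "snd p \<in> K" by auto
      then show "fst p \<otimes> x \<otimes> snd p \<in> dcoset x" unfolding in_dcoset by blast
    qed
  qed
  finally show ?thesis by (simp add: card_cartesian_product)
qed

text \<open>
  On a double coset that is mapped to itself, \<open>F g\<close> may be replaced by a fixed base point, and then
  every pair \<open>(h, k)\<close> is counted exactly once. On the other double cosets no solution exists, since
  \<open>F g\<close> and \<open>g\<close> lie in different ones.
\<close>

lemma card_fixed_double_cosets:
  assumes FD: "\<And>D. D \<in> double_cosets G H K \<Longrightarrow> F ` D \<in> double_cosets G H K"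
  shows "(\<Sum>g\<in>carrier G. links (F g) g) =
    card H * card K * card {D \<in> double_cosets G H K. F ` D = D}"
proof -
  let ?D = "double_cosets G H K"
  have fin: "finite D" if "D \<in> ?D" for D
    using double_coset_eq_dcoset(1)[OF that] finite_subset[OF _ finite_carrier] by blast
  have disj: "A \<inter> B = {}" if "A \<in> ?D" "B \<in> ?D" "A \<noteq> B" for A B
    using double_coset_eq_dcoset(2) that by blast
  have "(\<Sum>g\<in>carrier G. links (F g) g) = (\<Sum>D\<in>?D. \<Sum>g\<in>D. links (F g) g)"
    unfolding Union_double_cosets[symmetric] using fin disj
    by (subst sum.Union_disjoint) auto
  also have "\<dots> = (\<Sum>D\<in>?D. if F ` D = D then card H * card K else 0)"
  proof (intro sum.cong refl)
    fix D assume D: "D \<in> ?D"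
    show "(\<Sum>g\<in>D. links (F g) g) = (if F ` D = D then card H * card K else 0)"
    proof (cases "F ` D = D")
      case True
      obtain x where x: "x \<in> carrier G" "D = dcoset x" using D by (rule double_cosetsE)
      have "(\<Sum>g\<in>D. links (F g) g) = (\<Sum>g\<in>D. links x g)"
        using True x by (intro sum.cong refl links_cong_left) auto
      then show ?thesis using True sum_links_dcoset x by simp
    next
      case False
      have "links (F g) g = 0" if g: "g \<in> D" for g
      proof -
        have "F g \<in> F ` D" using g by blast
        then have Fg: "F g \<in> carrier G" "dcoset (F g) = F ` D"
          using double_coset_eq_dcoset[OF FD[OF D]] by blast+
        have "g \<notin> F ` D" using disj[OF FD[OF D] D False] g by blast
        then have "g \<notin> dcoset (F g)" using Fg by simp
        then have "fst p \<otimes> F g \<otimes> snd p \<noteq> g" if "p \<in> H \<times> K" for p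
          using that unfolding in_dcoset mem_Times_iff by metis
        then have "{p \<in> H \<times> K. fst p \<otimes> F g \<otimes> snd p = g} = {}" by blast
        then show ?thesis unfolding links_def by (simp only: card.empty)
      qed
      then show ?thesis using False by simp
    qed
  qed
  also have "\<dots> = card H * card K * card {D \<in> ?D. F ` D = D}"
    using finite_double_cosets by (simp add: sum.If_cases Int_def conj_commute)
  finally show ?thesis .
qed

text \<open>
  The condition \<open>h \<otimes> F g \<otimes> k \<otimes> inv g = \<one>\<close> is expanded by the regular character.
\<close>

lemma sum_links_characters:
  assumes F: "\<And>g. g \<in> carrier G \<Longrightarrow> F g \<in> carrier G"
  shows "of_nat (card (carrier G)) * of_nat (\<Sum>g\<in>carrier G. links (F g) g) =
    (\<Sum>C\<in>irr G. of_nat (fst (representative C)) *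
      (\<Sum>h\<in>H. \<Sum>k\<in>K. \<Sum>g\<in>carrier G. chi (representative C) (h \<otimes> F g \<otimes> k \<otimes> inv g)))"
proof -
  let ?N = "of_nat (card (carrier G)) :: complex"
  note fin = subgroup_finite[OF H] subgroup_finite[OF K]
  have links: "?N * of_nat (links (F g) g) = (\<Sum>h\<in>H. \<Sum>k\<in>K. \<Sum>C\<in>irr G.
      of_nat (fst (representative C)) * chi (representative C) (h \<otimes> F g \<otimes> k \<otimes> inv g))"
    if g: "g \<in> carrier G" for g
  proof -
    have "?N * of_nat (links (F g) g) = (\<Sum>p\<in>H \<times> K. if fst p \<otimes> F g \<otimes> snd p = g then ?N else 0)"
      unfolding links_def using fin
      by (simp add: sum.If_cases Collect_conj_eq)
    also have "\<dots> = (\<Sum>h\<in>H. \<Sum>k\<in>K. if h \<otimes> F g \<otimes> k = g then ?N else 0)"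
      by (simp add: sum.cartesian_product case_prod_unfold)
    also have "\<dots> = (\<Sum>h\<in>H. \<Sum>k\<in>K. \<Sum>C\<in>irr G.
      of_nat (fst (representative C)) * chi (representative C) (h \<otimes> F g \<otimes> k \<otimes> inv g))"
    proof (intro sum.cong refl)
      fix h k assume "h \<in> H" "k \<in> K"
      then have hk: "h \<otimes> F g \<otimes> k \<in> carrier G" using g F by simp
      then have "h \<otimes> F g \<otimes> k = g \<longleftrightarrow> h \<otimes> F g \<otimes> k \<otimes> inv g = \<one>"
        using g by (metis inv_closed inv_equality inv_inv r_inv)
      then show "(if h \<otimes> F g \<otimes> k = g then ?N else 0) = (\<Sum>C\<in>irr G.
          of_nat (fst (representative C)) * chi (representative C) (h \<otimes> F g \<otimes> k \<otimes> inv g))"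
        using sum_dim_chi[of "h \<otimes> F g \<otimes> k \<otimes> inv g"] hk g by simp
    qed
    finally show ?thesis .
  qed
  have "?N * of_nat (\<Sum>g\<in>carrier G. links (F g) g) = (\<Sum>g\<in>carrier G. ?N * of_nat (links (F g) g))"
    by (simp add: sum_distrib_left)
  also have "\<dots> = (\<Sum>g\<in>carrier G. \<Sum>h\<in>H. \<Sum>k\<in>K. \<Sum>C\<in>irr G.
      of_nat (fst (representative C)) * chi (representative C) (h \<otimes> F g \<otimes> k \<otimes> inv g))"
    by (intro sum.cong refl links)
  also have "\<dots> = (\<Sum>C\<in>irr G. \<Sum>h\<in>H. \<Sum>k\<in>K. \<Sum>g\<in>carrier G.
      of_nat (fst (representative C)) * chi (representative C) (h \<otimes> F g \<otimes> k \<otimes> inv g))"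
    by (simp only: sum.swap[of _ "irr G"] sum.swap[of _ _ "carrier G"])
  finally show ?thesis by (simp only: sum_distrib_left)
qed

lemma card_double_cosets:
  "card (double_cosets G H K) =
    (\<Sum>C\<in>irr G. dim_invariants (representative C) H * dim_invariants (representative C) K)"
proof -
  let ?N = "of_nat (card (carrier G)) :: complex"
  let ?c = "of_nat (card H) * of_nat (card K) :: complex"
  have pos: "card H > 0" "card K > 0"
    using subgroup_finite H K subgroup.one_closed by (auto simp: card_gt_0_iff)
  have "?N * (?c * of_nat (card (double_cosets G H K))) = ?N * of_nat (\<Sum>g\<in>carrier G. links g g)"
    using card_fixed_double_cosets[of "\<lambda>g. g"] by simp
  also have "\<dots> = (\<Sum>C\<in>irr G. of_nat (fst (representative C)) *
      (\<Sum>h\<in>H. \<Sum>k\<in>K. \<Sum>g\<in>carrier G. chi (representative C) (h \<otimes> g \<otimes> k \<otimes> inv g)))"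
    by (rule sum_links_characters)
  also have "\<dots> = (\<Sum>C\<in>irr G. ?N * (?c *
      of_nat (dim_invariants (representative C) H * dim_invariants (representative C) K)))"
  proof (intro sum.cong refl)
    fix C assume "C \<in> irr G"
    let ?\<pi> = "representative C"
    have \<pi>: "irreducible_rep G ?\<pi>" by (rule representative_irreducible) fact
    note rep = irreducible_repD[OF \<pi>]
    have "(\<Sum>h\<in>H. \<Sum>k\<in>K. \<Sum>g\<in>carrier G. chi ?\<pi> (h \<otimes> g \<otimes> k \<otimes> inv g)) =
        (\<Sum>h\<in>H. \<Sum>k\<in>K. ?N / of_nat (fst ?\<pi>) * (chi ?\<pi> h * chi ?\<pi> k))"
      by (simp add: sum_chi_conj_mult[OF \<pi>] mult.assoc)
    also have "\<dots> = ?N / of_nat (fst ?\<pi>) * ((\<Sum>h\<in>H. chi ?\<pi> h) * (\<Sum>k\<in>K. chi ?\<pi> k))"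
      unfolding sum_product by (simp only: sum_distrib_left)
    finally have "of_nat (fst ?\<pi>) * (\<Sum>h\<in>H. \<Sum>k\<in>K. \<Sum>g\<in>carrier G. chi ?\<pi> (h \<otimes> g \<otimes> k \<otimes> inv g)) =
        ?N * ((\<Sum>h\<in>H. chi ?\<pi> h) * (\<Sum>k\<in>K. chi ?\<pi> k))"
      using rep(2) by simp
    then show "of_nat (fst ?\<pi>) * (\<Sum>h\<in>H. \<Sum>k\<in>K. \<Sum>g\<in>carrier G. chi ?\<pi> (h \<otimes> g \<otimes> k \<otimes> inv g)) =
        ?N * (?c * of_nat (dim_invariants ?\<pi> H * dim_invariants ?\<pi> K))"
      by (simp add: sum_chi_subgroup[OF rep(1) H] sum_chi_subgroup[OF rep(1) K])
  qed
  also have "\<dots> = ?N * (?c * of_nat (\<Sum>C\<in>irr G.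
      dim_invariants (representative C) H * dim_invariants (representative C) K))"
    by (simp only: sum_distrib_left of_nat_sum)
  finally show ?thesis using pos order_pos by (simp only: mult_cancel_left of_nat_eq_iff) simp
qed

end

end

context finite_group_involution begin

lemma subgroup_image: "subgroup H G \<Longrightarrow> subgroup (\<theta> ` H) G"
  by (rule \<theta>.subgroup_img_is_subgroup)

lemma inj_on_\<theta>: "inj_on \<theta> (carrier G)"
  by (rule inj_on_inverseI[of _ \<theta>]) simp

lemma bij_\<theta>: "bij_betw \<theta> (carrier G) (carrier G)"
  by (rule bij_betwI[of _ _ _ \<theta>]) auto

context
  fixes H :: "'a set"
  assumes H: "subgroup H G"
begin

text \<open>
  The anti-automorphism \<open>\<sigma>\<close> exchanges the left factor \<open>H\<close> with the right factor \<open>\<theta>(H)\<close>. One inclusion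
  suffices because \<open>\<sigma>\<close> is an involution.
\<close>

lemma anti_involution_image_dcoset:
  assumes g: "g \<in> carrier G"
  shows "(\<lambda>g. \<theta> (inv g)) ` (H <#> {g} <#> \<theta> ` H) = H <#> {\<theta> (inv g)} <#> \<theta> ` H"
proof -
  have HG: "h \<in> H \<Longrightarrow> h \<in> carrier G" for h using subgroup.subset[OF H] by blast
  note K = subgroup_image[OF H]
  have sub: "(\<lambda>g. \<theta> (inv g)) ` (H <#> {x} <#> \<theta> ` H) \<subseteq> H <#> {\<theta> (inv x)} <#> \<theta> ` H"
    if x: "x \<in> carrier G" for x
  proof
    fix y assume "y \<in> (\<lambda>g. \<theta> (inv g)) ` (H <#> {x} <#> \<theta> ` H)"
    then obtain a b where ab: "a \<in> H" "b \<in> H" "y = \<theta> (inv (a \<otimes> x \<otimes> \<theta> b))"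
      by (auto simp: in_dcoset[OF H K])
    have "y = inv b \<otimes> \<theta> (inv x) \<otimes> \<theta> (inv a)"
      using ab x HG by (simp add: inv_mult_group m_assoc)
    then show "y \<in> H <#> {\<theta> (inv x)} <#> \<theta> ` H"
      unfolding in_dcoset[OF H K] using subgroup.m_inv_closed[OF H] ab by blast
  qed
  have "y \<in> (\<lambda>g. \<theta> (inv g)) ` (H <#> {g} <#> \<theta> ` H)" if y: "y \<in> H <#> {\<theta> (inv g)} <#> \<theta> ` H" for y
  proof
    have yG: "y \<in> carrier G" using y g dcoset_subset[OF H K, of "\<theta> (inv g)"] by auto
    then show "y = \<theta> (inv (\<theta> (inv y)))" by simp
    have "\<theta> (inv y) \<in> H <#> {\<theta> (inv (\<theta> (inv g)))} <#> \<theta> ` H"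
    proof -
      have "\<theta> (inv g) \<in> carrier G" using g by simp
      from sub[OF this] y show ?thesis by blast
    qed
    then show "\<theta> (inv y) \<in> H <#> {g} <#> \<theta> ` H" using g by simp
  qed
  then show ?thesis using sub[OF g] by blast
qed

lemma anti_involution_double_cosets:
  assumes "D \<in> double_cosets G H (\<theta> ` H)"
  shows "(\<lambda>g. \<theta> (inv g)) ` D \<in> double_cosets G H (\<theta> ` H)"
  using assms anti_involution_image_dcoset double_cosetsI[OF H subgroup_image[OF H]]
  by (auto elim!: double_cosetsE[OF H subgroup_image[OF H]])

text \<open>
  Two changes of variables (\<open>g \<mapsto> g\<inverse>\<close>, then \<open>g = x k\<inverse>\<close>) and the invariance of the trace under cyclic
  permutation expose the twisted square \<open>\<theta>(x) x\<close>.
\<close>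

lemma sum_chi_anti_involution:
  assumes \<pi>: "irreducible_rep G \<pi>" and h: "h \<in> carrier G" and k: "k \<in> carrier G"
  shows "(\<Sum>g\<in>carrier G. chi \<pi> (h \<otimes> \<theta> (inv g) \<otimes> \<theta> k \<otimes> inv g)) =
    of_int (twisted_FS G \<theta> \<pi>) * of_nat (card (carrier G)) / of_nat (fst \<pi>) * chi \<pi> (inv k \<otimes> h)"
proof -
  note rep = irreducible_repD(1)[OF \<pi>]
  have "(\<Sum>g\<in>carrier G. chi \<pi> (h \<otimes> \<theta> (inv g) \<otimes> \<theta> k \<otimes> inv g)) =
      (\<Sum>g\<in>carrier G. chi \<pi> (h \<otimes> \<theta> g \<otimes> \<theta> k \<otimes> g))"
    by (rule sum.reindex_bij_betw[OF bij_inv, of "\<lambda>g. chi \<pi> (h \<otimes> \<theta> g \<otimes> \<theta> k \<otimes> g)"])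
  also have "\<dots> = (\<Sum>x\<in>carrier G. chi \<pi> (h \<otimes> \<theta> (x \<otimes> inv k) \<otimes> \<theta> k \<otimes> (x \<otimes> inv k)))"
    using k by (intro sum.reindex_bij_betw[OF bij_mult_right, symmetric]) simp
  also have "\<dots> = (\<Sum>x\<in>carrier G. chi \<pi> (inv k \<otimes> h \<otimes> \<theta> x \<otimes> \<theta> (\<theta> x)))"
  proof (intro sum.cong refl)
    fix x assume x: "x \<in> carrier G"
    have "h \<otimes> \<theta> (x \<otimes> inv k) \<otimes> \<theta> k \<otimes> (x \<otimes> inv k) = h \<otimes> \<theta> x \<otimes> (inv \<theta> k \<otimes> \<theta> k) \<otimes> x \<otimes> inv k"
      using h k x by (simp only: m_assoc \<theta>.hom_mult \<theta>.hom_inv m_closed inv_closed \<theta>.hom_closed)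
    also have "\<dots> = (h \<otimes> \<theta> x \<otimes> x) \<otimes> inv k" using h k x by simp
    finally show "chi \<pi> (h \<otimes> \<theta> (x \<otimes> inv k) \<otimes> \<theta> k \<otimes> (x \<otimes> inv k)) = chi \<pi> (inv k \<otimes> h \<otimes> \<theta> x \<otimes> \<theta> (\<theta> x))"
      using h k x chi_mult_commute[OF rep, of "h \<otimes> \<theta> x \<otimes> x" "inv k"] by (simp add: m_assoc)
  qed
  also have "\<dots> = (\<Sum>x\<in>carrier G. chi \<pi> (inv k \<otimes> h \<otimes> x \<otimes> \<theta> x))"
    by (rule sum.reindex_bij_betw[OF bij_\<theta>])
  also have "\<dots> = of_int (twisted_FS G \<theta> \<pi>) * of_nat (card (carrier G)) / of_nat (fst \<pi>) * chi \<pi> (inv k \<otimes> h)"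
    using h k by (subst sum_chi_twisted_square[OF \<pi> hom]) (auto simp: twisted_frobenius_schur[OF \<pi>])
  finally show ?thesis .
qed

lemma card_fixed_double_cosets_FS:
  "int (card {D \<in> double_cosets G H (\<theta> ` H). (\<lambda>g. \<theta> (inv g)) ` D = D}) =
    (\<Sum>C\<in>irr G. int (dim_invariants (representative C) H) * twisted_FS G \<theta> (representative C))"
proof -
  let ?N = "of_nat (card (carrier G)) :: complex"
  let ?c = "of_nat (card H) * of_nat (card H) :: complex"
  let ?X = "{D \<in> double_cosets G H (\<theta> ` H). (\<lambda>g. \<theta> (inv g)) ` D = D}"
  note K = subgroup_image[OF H]
  have HG: "h \<in> H \<Longrightarrow> h \<in> carrier G" for h using subgroup.subset[OF H] by blast
  have injH: "inj_on \<theta> H" using inj_on_subset[OF inj_on_\<theta> subgroup.subset[OF H]] .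
  have pos: "card H > 0" using subgroup_finite[OF H] subgroup.one_closed[OF H] by (auto simp: card_gt_0_iff)
  have "?N * (?c * of_nat (card ?X)) = ?N * of_nat (\<Sum>g\<in>carrier G. links H (\<theta> ` H) (\<theta> (inv g)) g)"
  proof -
    have "(\<Sum>g\<in>carrier G. links H (\<theta> ` H) (\<theta> (inv g)) g) = card H * card (\<theta> ` H) * card ?X"
      by (rule card_fixed_double_cosets[OF H K anti_involution_double_cosets])
    then show ?thesis by (simp only: card_image[OF injH] of_nat_mult)
  qed
  also have "\<dots> = (\<Sum>C\<in>irr G. of_nat (fst (representative C)) *
      (\<Sum>h\<in>H. \<Sum>k\<in>\<theta> ` H. \<Sum>g\<in>carrier G. chi (representative C) (h \<otimes> \<theta> (inv g) \<otimes> k \<otimes> inv g)))"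
    by (rule sum_links_characters[OF H K]) simp
  also have "\<dots> = (\<Sum>C\<in>irr G. ?N * (?c *
      of_int (int (dim_invariants (representative C) H) * twisted_FS G \<theta> (representative C))))"
  proof (intro sum.cong refl)
    fix C assume "C \<in> irr G"
    let ?\<pi> = "representative C"
    have \<pi>: "irreducible_rep G ?\<pi>" by (rule representative_irreducible) fact
    note rep = irreducible_repD[OF \<pi>]
    let ?e = "of_int (twisted_FS G \<theta> ?\<pi>) :: complex"
    \<comment> \<open>Left translation by an element of \<open>H\<close> is absorbed in the sum over \<open>H\<close>.\<close>
    have shift: "(\<Sum>h\<in>H. chi ?\<pi> (inv k \<otimes> h)) = (\<Sum>h\<in>H. chi ?\<pi> h)" if k: "k \<in> H" for k
      using k HG subgroup.m_closed[OF H] subgroup.m_inv_closed[OF H]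
      by (intro sum.reindex_bij_betw bij_betwI[of _ _ _ "\<lambda>h. k \<otimes> h"]) (auto simp flip: m_assoc)
    have "(\<Sum>h\<in>H. \<Sum>k\<in>\<theta> ` H. \<Sum>g\<in>carrier G. chi ?\<pi> (h \<otimes> \<theta> (inv g) \<otimes> k \<otimes> inv g)) =
        (\<Sum>h\<in>H. \<Sum>k\<in>H. ?e * ?N / of_nat (fst ?\<pi>) * chi ?\<pi> (inv k \<otimes> h))"
      by (simp add: sum.reindex[OF injH] sum_chi_anti_involution[OF \<pi>] HG del: \<theta>.hom_inv)
    also have "\<dots> = ?e * ?N / of_nat (fst ?\<pi>) * (\<Sum>k\<in>H. \<Sum>h\<in>H. chi ?\<pi> (inv k \<otimes> h))"
      by (subst sum.swap) (simp only: sum_distrib_left)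
    also have "(\<Sum>k\<in>H. \<Sum>h\<in>H. chi ?\<pi> (inv k \<otimes> h)) = ?c * of_nat (dim_invariants ?\<pi> H)"
      by (simp add: shift sum_chi_subgroup[OF rep(1) H])
    finally show "of_nat (fst ?\<pi>) *
        (\<Sum>h\<in>H. \<Sum>k\<in>\<theta> ` H. \<Sum>g\<in>carrier G. chi ?\<pi> (h \<otimes> \<theta> (inv g) \<otimes> k \<otimes> inv g)) =
        ?N * (?c * of_int (int (dim_invariants ?\<pi> H) * twisted_FS G \<theta> ?\<pi>))"
      using rep(2) by simp
  qed
  also have "\<dots> = ?N * (?c * of_int (\<Sum>C\<in>irr G.
      int (dim_invariants (representative C) H) * twisted_FS G \<theta> (representative C)))"
    by (simp only: sum_distrib_left of_int_sum)
  finally have "of_nat (card ?X) = (of_int (\<Sum>C\<in>irr G.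
      int (dim_invariants (representative C) H) * twisted_FS G \<theta> (representative C)) :: complex)"
    using pos order_pos by (simp only: mult_cancel_left) simp
  then have "(of_int (int (card ?X)) :: complex) = of_int (\<Sum>C\<in>irr G.
      int (dim_invariants (representative C) H) * twisted_FS G \<theta> (representative C))"
    by (simp only: of_int_of_nat_eq)
  then show ?thesis by (simp only: of_int_eq_iff)
qed

end

end

theorem corollary5:
  fixes G :: "('a, 'b) monoid_scheme" and \<theta> \<sigma> :: "'a \<Rightarrow> 'a" and H :: "'a set"
  assumes "group G" and "finite (carrier G)"
    and "involution G \<theta>"
    and "subgroup H G"
    and "\<And>g. g \<in> carrier G \<Longrightarrow> \<sigma> g = \<theta> (inv\<^bsub>G\<^esub> g)"
  shows "(\<forall>D \<in> double_cosets G H (\<theta> ` H). \<sigma> ` D \<in> double_cosets G H (\<theta> ` H)) \<and>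
    int (card {D \<in> double_cosets G H (\<theta> ` H). \<sigma> ` D \<noteq> D}) =
      (\<Sum>C \<in> irr G. let \<pi> = representative C in
         int (dim_invariants \<pi> H) * (int (dim_invariants \<pi> (\<theta> ` H)) - twisted_FS G \<theta> \<pi>))"
proof -
  interpret finite_group_involution G \<theta>
    using assms(1-3)
    by (auto simp: finite_group_involution_def finite_group_involution_axioms_def
        finite_group_def finite_group_axioms_def involution_def iso_def)
  note H = \<open>subgroup H G\<close>
  note K = subgroup_image[OF H]
  let ?D = "double_cosets G H (\<theta> ` H)"
  have \<sigma>: "\<sigma> ` A = (\<lambda>g. \<theta> (inv\<^bsub>G\<^esub> g)) ` A" if "A \<in> ?D" for A
    using double_coset_eq_dcoset(1)[OF H K that] assms(5) by (intro image_cong) auto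
  have "\<forall>A\<in>?D. \<sigma> ` A \<in> ?D"
    using anti_involution_double_cosets[OF H] \<sigma> by simp
  moreover have "int (card {A \<in> ?D. \<sigma> ` A \<noteq> A}) =
      int (card ?D) - int (card {A \<in> ?D. (\<lambda>g. \<theta> (inv\<^bsub>G\<^esub> g)) ` A = A})"
  proof -
    have "{A \<in> ?D. \<sigma> ` A \<noteq> A} = ?D - {A \<in> ?D. (\<lambda>g. \<theta> (inv\<^bsub>G\<^esub> g)) ` A = A}"
      using \<sigma> by auto
    moreover have "card {A \<in> ?D. (\<lambda>g. \<theta> (inv\<^bsub>G\<^esub> g)) ` A = A} \<le> card ?D"
      by (intro card_mono finite_double_cosets[OF H K]) auto
    ultimately show ?thesis
      using finite_double_cosets[OF H K] by (simp add: card_Diff_subset)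
  qed
  ultimately show ?thesis
    unfolding card_double_cosets[OF H K] card_fixed_double_cosets_FS[OF H]
    by (simp add: Let_def right_diff_distrib sum_subtractf)
qed

end
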